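(* Let $Q$ be a quadrangulation with vertices properly colored black and white, and let $s_0,s_1$ be the two black vertices on its outer face. Then the strong labelings of $Q$ (with these special vertices) are in bijection with the separating decompositions of $Q$ with sinks $s_0,s_1$.
   Context: A quadrangulation is a simple plane graph with at least four vertices all of whose faces (including the outer face) are bounded by $4$-cycles. An angle is an incidence of a vertex with a face. A strong labeling of $Q$ is a map from the angles of $Q$ to $\{0,1\}$ such that: (G0) all angles at $s_i$ are labeled $i$; (G1) for each vertex $v\notin\{s_0,s_1\}$ the labels around $v$ form one non-empty cyclic interval of $1$s and one non-empty cyclic interval of $0$s; (G2) for each edge, the two labels on the two sides of the edge coincide at one endpoint and differ at the other; (G3) the labels in each bounded face, read cyclically, are $0,0,1,1$, and reading the labels of the outer face in clockwise order starting at $s_0$ they are $0,0,1,1$. A separating decomposition of $Q$ is a partition of its edge set into two directed trees $T_0,T_1$ with sinks $s_0,s_1$ respectively (all edges of $T_i$ oriented towards $s_i$), such that at each vertex other than $s_0,s_1$ the incident edges appear, in clockwise order for black vertices and counterclockwise order for white vertices, as: the incoming edges (if any) of $T_0$, then the outgoing edge of $T_0$, then the incoming edges (if any) of $T_1$, then the outgoing edge of $T_1$. *)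

theory Defs
  imports Main "HOL-Library.FuncSet"
begin

text \<open>Combinatorial (rotation-system) representation of a plane graph.
  D: darts (half-edges); alpha: the opposite dart of the same edge;
  sigma: the clockwise successor of a dart around its tail vertex;
  vert d: the tail vertex of dart d.  The angle (corner) associated with dart d
  is the angle at vert d between d and sigma d.  The face of that angle is
  traversed by phi = alpha o sigma (this walks bounded faces counterclockwise
  and the outer face clockwise).\<close>

definition phi :: "('d \<Rightarrow> 'd) \<Rightarrow> ('d \<Rightarrow> 'd) \<Rightarrow> 'd \<Rightarrow> 'd" where
  "phi alpha sigma d = alpha (sigma d)"

definition face_of :: "('d \<Rightarrow> 'd) \<Rightarrow> ('d \<Rightarrow> 'd) \<Rightarrow> 'd \<Rightarrow> 'd set" where
  "face_of alpha sigma d = {(phi alpha sigma ^^ n) d | n. True}"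

definition map_rel :: "'d set \<Rightarrow> ('d \<Rightarrow> 'd) \<Rightarrow> ('d \<Rightarrow> 'd) \<Rightarrow> ('d \<times> 'd) set" where
  "map_rel D alpha sigma = {(d, alpha d) | d. d \<in> D} \<union> {(d, sigma d) | d. d \<in> D}"

definition plane_map :: "'d set \<Rightarrow> ('d \<Rightarrow> 'd) \<Rightarrow> ('d \<Rightarrow> 'd) \<Rightarrow> ('d \<Rightarrow> 'v) \<Rightarrow> bool" where
  "plane_map D alpha sigma vert \<longleftrightarrow>
     finite D \<and> D \<noteq> {} \<and>
     bij_betw alpha D D \<and> (\<forall>d\<in>D. alpha d \<noteq> d \<and> alpha (alpha d) = d) \<and>
     bij_betw sigma D D \<and> (\<forall>d\<in>D. vert (sigma d) = vert d) \<and>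
     (\<forall>d\<in>D. \<forall>d'\<in>D. vert d = vert d' \<longrightarrow> (\<exists>n. (sigma ^^ n) d = d')) \<and>
     (\<forall>d\<in>D. \<forall>d'\<in>D. (d, d') \<in> (map_rel D alpha sigma)\<^sup>*) \<and>
     2 * (card (vert ` D) + card (face_of alpha sigma ` D)) = card D + 4"

definition simple_map :: "'d set \<Rightarrow> ('d \<Rightarrow> 'd) \<Rightarrow> ('d \<Rightarrow> 'v) \<Rightarrow> bool" where
  "simple_map D alpha vert \<longleftrightarrow>
     (\<forall>d\<in>D. vert (alpha d) \<noteq> vert d) \<and>
     (\<forall>d\<in>D. \<forall>d'\<in>D. vert d = vert d' \<and> vert (alpha d) = vert (alpha d') \<longrightarrow> d = d')"

definition quadrangulation :: "'d set \<Rightarrow> ('d \<Rightarrow> 'd) \<Rightarrow> ('d \<Rightarrow> 'd) \<Rightarrow> ('d \<Rightarrow> 'v) \<Rightarrow> bool" where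
  "quadrangulation D alpha sigma vert \<longleftrightarrow>
     plane_map D alpha sigma vert \<and> simple_map D alpha vert \<and>
     card (vert ` D) \<ge> 4 \<and>
     (\<forall>d\<in>D. card (face_of alpha sigma d) = 4 \<and> card (vert ` face_of alpha sigma d) = 4)"

definition proper_bw_coloring :: "'d set \<Rightarrow> ('d \<Rightarrow> 'd) \<Rightarrow> ('d \<Rightarrow> 'v) \<Rightarrow> ('v \<Rightarrow> bool) \<Rightarrow> bool" where
  "proper_bw_coloring D alpha vert black \<longleftrightarrow> (\<forall>d\<in>D. black (vert d) \<noteq> black (vert (alpha d)))"

text \<open>A set of darts is a cyclic interval w.r.t. the rotation sigma.\<close>
definition cyc_interval :: "('d \<Rightarrow> 'd) \<Rightarrow> 'd set \<Rightarrow> bool" where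
  "cyc_interval sigma S \<longleftrightarrow> (\<exists>d k. S = {(sigma ^^ i) d | i. i < k})"

text \<open>Strong labelings: maps from angles (= darts) to {0,1}.\<close>
definition strong_labeling ::
  "'d set \<Rightarrow> ('d \<Rightarrow> 'd) \<Rightarrow> ('d \<Rightarrow> 'd) \<Rightarrow> ('d \<Rightarrow> 'v) \<Rightarrow> 'd \<Rightarrow> 'v \<Rightarrow> 'v \<Rightarrow> ('d \<Rightarrow> nat) \<Rightarrow> bool" where
  "strong_labeling D alpha sigma vert outer s0 s1 lab \<longleftrightarrow>
     lab \<in> D \<rightarrow>\<^sub>E {0, 1} \<and>
     \<comment> \<open>G0\<close>
     (\<forall>d\<in>D. (vert d = s0 \<longrightarrow> lab d = 0) \<and> (vert d = s1 \<longrightarrow> lab d = 1)) \<and>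
     \<comment> \<open>G1\<close>
     (\<forall>v\<in>vert ` D. v \<notin> {s0, s1} \<longrightarrow>
        {d\<in>D. vert d = v \<and> lab d = 1} \<noteq> {} \<and> {d\<in>D. vert d = v \<and> lab d = 0} \<noteq> {} \<and>
        cyc_interval sigma {d\<in>D. vert d = v \<and> lab d = 1} \<and>
        cyc_interval sigma {d\<in>D. vert d = v \<and> lab d = 0}) \<and>
     \<comment> \<open>G2\<close>
     (\<forall>d\<in>D. (lab d = lab (inv_into D sigma d)) \<noteq>
              (lab (alpha d) = lab (inv_into D sigma (alpha d)))) \<and>
     \<comment> \<open>G3, bounded faces\<close>
     (\<forall>d\<in>D. face_of alpha sigma d \<noteq> face_of alpha sigma outer \<longrightarrow>
        (\<exists>c\<in>face_of alpha sigma d. lab c = 0 \<and> lab (phi alpha sigma c) = 0 \<and>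
            lab ((phi alpha sigma ^^ 2) c) = 1 \<and> lab ((phi alpha sigma ^^ 3) c) = 1)) \<and>
     \<comment> \<open>G3, outer face, clockwise starting at s0\<close>
     (\<exists>c\<in>face_of alpha sigma outer. vert c = s0 \<and> lab c = 0 \<and> lab (phi alpha sigma c) = 0 \<and>
            lab ((phi alpha sigma ^^ 2) c) = 1 \<and> lab ((phi alpha sigma ^^ 3) c) = 1)"

text \<open>A set A of darts, each read as an arc vert d -> vert (alpha d), is a directed
  tree all of whose arcs are oriented towards the sink s.\<close>
definition directed_tree_to :: "('d \<Rightarrow> 'd) \<Rightarrow> ('d \<Rightarrow> 'v) \<Rightarrow> 'd set \<Rightarrow> 'v \<Rightarrow> bool" where
  "directed_tree_to alpha vert A s \<longleftrightarrow>
     (let W = {s} \<union> vert ` A \<union> (\<lambda>d. vert (alpha d)) ` A;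
          arcs = {(vert d, vert (alpha d)) | d. d \<in> A}
      in (\<forall>d\<in>A. vert d \<noteq> s) \<and>
         (\<forall>v\<in>W. v \<noteq> s \<longrightarrow> card {d\<in>A. vert d = v} = 1) \<and>
         (\<forall>v\<in>W. (v, s) \<in> arcs\<^sup>*))"

text \<open>Separating decomposition, given by the arc sets (T0, T1).\<close>
definition separating_decomposition ::
  "'d set \<Rightarrow> ('d \<Rightarrow> 'd) \<Rightarrow> ('d \<Rightarrow> 'd) \<Rightarrow> ('d \<Rightarrow> 'v) \<Rightarrow> ('v \<Rightarrow> bool) \<Rightarrow> 'v \<Rightarrow> 'v \<Rightarrow>
   'd set \<times> 'd set \<Rightarrow> bool" where
  "separating_decomposition D alpha sigma vert black s0 s1 T \<longleftrightarrow>
     (let T0 = fst T; T1 = snd T in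
       T0 \<subseteq> D \<and> T1 \<subseteq> D \<and> T0 \<inter> T1 = {} \<and>
       (\<forall>d\<in>D. (d \<in> T0 \<union> T1) \<noteq> (alpha d \<in> T0 \<union> T1)) \<and>
       directed_tree_to alpha vert T0 s0 \<and> directed_tree_to alpha vert T1 s1 \<and>
       (\<forall>v\<in>vert ` D. v \<notin> {s0, s1} \<longrightarrow>
          (let rot = (if black v then sigma else inv_into D sigma);
               deg = card {d\<in>D. vert d = v}
           in \<exists>d\<in>D. vert d = v \<and> (\<exists>a. a + 1 < deg \<and>
                (\<forall>j<a. alpha ((rot ^^ j) d) \<in> T0) \<and>
                (rot ^^ a) d \<in> T0 \<and>
                (\<forall>j. a < j \<and> j + 1 < deg \<longrightarrow> alpha ((rot ^^ j) d) \<in> T1) \<and>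
                (rot ^^ (deg - 1)) d \<in> T1))))"

end

theory Submission
  imports Defs
begin

text \<open>
  A labeling is strong iff it satisfies (G0), (G1) and, along every face in the direction of phi,
  the label stays the same after a black angle and changes after a white one; (G2) carries this
  rule from the outer face to all others. An edge is oriented away from the endpoint where its two
  labels differ and coloured by the common label at the other endpoint. Conversely, an angle gets
  the colour of the next edge clockwise at a black vertex, of the next edge counterclockwise at a
  white one; the order of the edges around the vertices then gives the rule for faces.

  The global point is that the arcs of colour i contain no directed cycle. By Euler's formula such
  a cycle C cuts off a non-empty set K of faces from the outer face. The edges of the other colour
  inside K can be followed forever without leaving K: the angles with that label at a vertex are
  either all in K or all outside K, and outside K at the sink, which lies on the outer face. So
  these edges contain a directed cycle, which cuts off strictly fewer faces than C, and infinite
  descent gives a contradiction.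
\<close>

section \<open>Permutations and reachability\<close>

lemma finite_perm_period:
  assumes "finite D" "bij_betw f D D" "x \<in> D"
  shows "\<exists>n>0. (f ^^ n) x = x"
proof -
  have bij: "bij_betw (f ^^ n) D D" for n
    using assms(2) by (rule bij_betw_funpow)
  have "range (\<lambda>n. (f ^^ n) x) \<subseteq> D"
    using bij assms(3) by (auto dest: bij_betwE)
  then have "\<not> inj (\<lambda>n. (f ^^ n) x)"
    using assms(1) finite_subset infinite_UNIV_nat finite_imageD by blast
  then obtain i j where ij: "i < j" "(f ^^ i) x = (f ^^ j) x"
    using linorder_injI[of "\<lambda>n. (f ^^ n) x"] by blast
  then have "(f ^^ i) ((f ^^ (j - i)) x) = (f ^^ i) x"
    by (metis add_diff_inverse_nat comp_apply funpow_add less_imp_not_less)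
  moreover have "(f ^^ (j - i)) x \<in> D"
    using bij assms(3) by (auto dest: bij_betwE)
  ultimately have "(f ^^ (j - i)) x = x"
    using bij[of i] assms(3) by (auto simp: bij_betw_def dest: inj_onD)
  then show ?thesis using ij(1) by (intro exI[of _ "j - i"]) simp
qed

text \<open>The least positive return time \<open>p\<close> of \<open>x\<close> is the cycle length:
  minimality keeps the first \<open>p\<close> iterates distinct, and by transitivity they exhaust
  \<open>A\<close>. It serves both for a face under \<open>ph\<close> and for a vertex under its
  rotation.\<close>

lemma transitive_perm_cycle:
  assumes "finite A" "bij_betw r A A" "x \<in> A" "\<And>y. y \<in> A \<Longrightarrow> \<exists>n. (r ^^ n) x = y"
  shows "(r ^^ card A) x = x"
    and "A = (\<lambda>j. (r ^^ j) x) ` {..<card A}"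
    and "inj_on (\<lambda>j. (r ^^ j) x) {..<card A}"
proof -
  define p where "p = (LEAST n. n > 0 \<and> (r ^^ n) x = x)"
  have "\<exists>n. n > 0 \<and> (r ^^ n) x = x"
    using finite_perm_period[OF assms(1-3)] by blast
  then have p: "p > 0" "(r ^^ p) x = x" unfolding p_def by (metis (mono_tags, lifting) LeastI)+
  have least: "(r ^^ n) x \<noteq> x" if "0 < n" "n < p" for n
    using not_less_Least[of n "\<lambda>n. n > 0 \<and> (r ^^ n) x = x"] that unfolding p_def by auto
  have neq: "(r ^^ i) x \<noteq> (r ^^ j) x" if "i < j" "j < p" for i j
  proof
    assume eq: "(r ^^ i) x = (r ^^ j) x"
    \<comment> \<open>The remaining \<open>p - j\<close> steps lead from the \<open>j\<close>-th
      iterate to \<open>x\<close>; started at the equal \<open>i\<close>-th iterate, they would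
      return to \<open>x\<close> before time \<open>p\<close>.\<close>
    have "(r ^^ (p - j + i)) x = (r ^^ (p - j)) ((r ^^ j) x)"
      using eq by (simp add: funpow_add)
    also have "\<dots> = (r ^^ (p - j + j)) x" by (simp only: funpow_add comp_apply)
    also have "\<dots> = x" using p that by simp
    finally show False using least[of "p - j + i"] that by linarith
  qed
  have inj: "inj_on (\<lambda>j. (r ^^ j) x) {..<p}"
    by (rule inj_onI) (metis lessThan_iff linorder_neqE_nat neq)
  have img: "A = (\<lambda>j. (r ^^ j) x) ` {..<p}"
  proof (intro equalityI subsetI)
    fix y assume "y \<in> A"
    then obtain n where "(r ^^ n) x = y" using assms(4) by blast
    then have "(r ^^ (n mod p)) x = y" using funpow_mod_eq[OF p(2)] by simp
    then show "y \<in> (\<lambda>j. (r ^^ j) x) ` {..<p}" using p(1) by force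
  next
    fix y assume "y \<in> (\<lambda>j. (r ^^ j) x) ` {..<p}"
    then show "y \<in> A"
      using bij_betw_funpow[OF assms(2)] assms(3) by (auto dest: bij_betwE)
  qed
  have "card A = p" by (subst img) (simp add: card_image[OF inj])
  then show "(r ^^ card A) x = x" "A = (\<lambda>j. (r ^^ j) x) ` {..<card A}"
    "inj_on (\<lambda>j. (r ^^ j) x) {..<card A}"
    using p img inj by auto
qed

text \<open>The rank is the distance from \<open>U\<close>. Choosing for each element a predecessor
  of smaller rank turns reachability into a spanning forest rooted at \<open>U\<close>; this is done
  below once for faces and once for vertices.\<close>

lemma reachable_rank:
  assumes "\<And>x. x \<in> A \<Longrightarrow> \<exists>u\<in>U. (u, x) \<in> R\<^sup>*"
  obtains h :: "'a \<Rightarrow> nat"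
  where "\<And>x. x \<in> A \<Longrightarrow> x \<notin> U \<Longrightarrow> \<exists>y. (y, x) \<in> R \<and> h y < h x"
proof
  define h where "h x = (LEAST n. \<exists>u\<in>U. (u, x) \<in> R ^^ n)" for x
  fix x assume x: "x \<in> A" "x \<notin> U"
  then have "\<exists>n. \<exists>u\<in>U. (u, x) \<in> R ^^ n"
    using assms rtrancl_imp_relpow by metis
  then have "\<exists>u\<in>U. (u, x) \<in> R ^^ h x" unfolding h_def by (rule LeastI_ex)
  then obtain u where u: "u \<in> U" "(u, x) \<in> R ^^ h x" by blast
  have "h x \<noteq> 0" using u x by (metis relpow_0_E)
  then obtain n where n: "h x = Suc n" by (cases "h x") auto
  then obtain y where y: "(u, y) \<in> R ^^ n" "(y, x) \<in> R" using u by (metis relpow_Suc_E)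
  have "h y \<le> n" unfolding h_def using u y by (blast intro: Least_le)
  then show "\<exists>y. (y, x) \<in> R \<and> h y < h x" using y n by auto
qed

text \<open>The same interval is read backwards from its last element. This makes (G1), phrased with
  the clockwise \<open>sigma\<close>, available at white vertices, which are read
  counterclockwise.\<close>

lemma cyc_interval_inverse:
  assumes inv: "\<And>x. x \<in> D \<Longrightarrow> f x \<in> D" "\<And>x. x \<in> D \<Longrightarrow> g (f x) = x"
    and S: "S \<subseteq> D" "cyc_interval f S"
  shows "cyc_interval g S"
proof -
  obtain d k where dk: "S = {(f ^^ i) d | i. i < k}" using S(2) unfolding cyc_interval_def by blast
  show ?thesis
  proof (cases k)
    case 0
    then show ?thesis using dk unfolding cyc_interval_def by auto
  next
    case (Suc n)
    have d: "d \<in> D" using S(1) dk Suc by (auto intro: exI[of _ 0])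
    have fD: "(f ^^ i) d \<in> D" for i by (induction i) (use d inv in auto)
    have g: "(g ^^ i) ((f ^^ (i + m)) d) = (f ^^ m) d" for i m
    proof (induction i)
      case (Suc i)
      have "(g ^^ Suc i) ((f ^^ (Suc i + m)) d) = (g ^^ i) (g (f ((f ^^ (i + m)) d)))"
        by (simp add: funpow_swap1)
      then show ?case using Suc inv(2)[OF fD] by simp
    qed simp
    have "S = {(g ^^ i) ((f ^^ n) d) | i. i < k}"
    proof (intro equalityI subsetI)
      fix x assume "x \<in> S"
      then obtain m where m: "x = (f ^^ m) d" "m \<le> n" using dk Suc by auto
      then have "x = (g ^^ (n - m)) ((f ^^ n) d)" using g[of "n - m" m] by simp
      then show "x \<in> {(g ^^ i) ((f ^^ n) d) | i. i < k}" using Suc by auto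
    next
      fix x assume "x \<in> {(g ^^ i) ((f ^^ n) d) | i. i < k}"
      then obtain i where i: "x = (g ^^ i) ((f ^^ n) d)" "i \<le> n" using Suc by auto
      then have "x = (f ^^ (n - i)) d" using g[of i "n - i"] by simp
      then show "x \<in> S" using dk Suc by auto
    qed
    then show ?thesis unfolding cyc_interval_def by blast
  qed
qed

text \<open>Heads of arcs belong to the vertex set of the tree. Used to exclude arcs of the wrong
  tree at the sinks.\<close>

lemma directed_tree_head_out:
  assumes "directed_tree_to alpha vert A r" "d \<in> A" "vert (alpha d) \<noteq> r"
  shows "\<exists>e\<in>A. vert e = vert (alpha d)"
proof -
  have "card {e\<in>A. vert e = vert (alpha d)} = 1"
    using assms unfolding directed_tree_to_def Let_def by auto
  then have "{e\<in>A. vert e = vert (alpha d)} \<noteq> {}" by (metis card.empty zero_neq_one)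
  then show ?thesis by blast
qed

lemma rtrancl_leaves_set:
  assumes "(x, y) \<in> R\<^sup>*" "x \<in> S" "y \<notin> S"
  obtains a b where "(a, b) \<in> R" "a \<in> S" "b \<notin> S"
  using assms by (induction rule: rtrancl_induct) blast+

section \<open>Plane maps\<close>

locale plane_rotation =
  fixes D :: "'d set" and alpha sigma :: "'d \<Rightarrow> 'd" and vert :: "'d \<Rightarrow> 'v"
  assumes plane: "plane_map D alpha sigma vert"
begin

abbreviation si where "si \<equiv> inv_into D sigma"
abbreviation ph where "ph \<equiv> phi alpha sigma"
abbreviation face where "face \<equiv> face_of alpha sigma"

lemma finite_D [simp]: "finite D"
  and alpha_in [simp]: "d \<in> D \<Longrightarrow> alpha d \<in> D"
  and alpha_alpha [simp]: "d \<in> D \<Longrightarrow> alpha (alpha d) = d"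
  and bij_sigma: "bij_betw sigma D D"
  and sigma_in [simp]: "d \<in> D \<Longrightarrow> sigma d \<in> D"
  and vert_sigma [simp]: "d \<in> D \<Longrightarrow> vert (sigma d) = vert d"
  and sigma_transitive: "d \<in> D \<Longrightarrow> d' \<in> D \<Longrightarrow> vert d = vert d' \<Longrightarrow> \<exists>n. (sigma ^^ n) d = d'"
  and map_connected: "d \<in> D \<Longrightarrow> d' \<in> D \<Longrightarrow> (d, d') \<in> (map_rel D alpha sigma)\<^sup>*"
  and euler: "2 * (card (vert ` D) + card (face ` D)) = card D + 4"
  using plane unfolding plane_map_def by (auto dest: bij_betwE)

lemma inj_alpha: "inj_on alpha D"
  by (metis alpha_alpha inj_onI)

lemma alpha_image_subset: "X \<subseteq> D \<Longrightarrow> alpha ` X \<subseteq> D"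
  by auto

lemma si_sigma [simp]: "d \<in> D \<Longrightarrow> si (sigma d) = d"
  using bij_sigma by (simp add: bij_betw_inv_into_left)

lemma sigma_si [simp]: "d \<in> D \<Longrightarrow> sigma (si d) = d"
  using bij_sigma by (simp add: bij_betw_inv_into_right)

lemma bij_si: "bij_betw si D D"
  using bij_sigma by (rule bij_betw_inv_into)

lemma si_in [simp]: "d \<in> D \<Longrightarrow> si d \<in> D"
  using bij_si by (auto dest: bij_betwE)

lemma vert_si [simp]: "d \<in> D \<Longrightarrow> vert (si d) = vert d"
  by (metis si_in sigma_si vert_sigma)

lemma ph_in [simp]: "d \<in> D \<Longrightarrow> ph d \<in> D"
  by (simp add: phi_def)

lemma bij_ph: "bij_betw ph D D"
proof -
  have "bij_betw alpha D D" using plane unfolding plane_map_def by blast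
  then have "bij_betw (alpha \<circ> sigma) D D" using bij_sigma bij_betw_trans by blast
  then show ?thesis by (simp add: phi_def[abs_def] comp_def)
qed

lemma funpow_ph_in: "d \<in> D \<Longrightarrow> (ph ^^ n) d \<in> D"
  by (induction n) auto

lemma self_in_face [simp]: "d \<in> face d"
  unfolding face_of_def by (auto intro: exI[of _ 0])

lemma funpow_ph_in_face: "(ph ^^ n) d \<in> face d"
  unfolding face_of_def by auto

lemma face_subset: "d \<in> D \<Longrightarrow> face d \<subseteq> D"
  unfolding face_of_def using funpow_ph_in by auto

lemma face_ph [simp]:
  assumes "d \<in> D" shows "face (ph d) = face d"
proof
  have "(ph ^^ n) (ph d) = (ph ^^ Suc n) d" for n by (simp add: funpow_swap1)
  then show "face (ph d) \<subseteq> face d"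
    unfolding face_of_def by blast
  obtain n where n: "n > 0" "(ph ^^ n) d = d"
    using finite_perm_period[OF finite_D bij_ph assms] by blast
  show "face d \<subseteq> face (ph d)"
  proof
    fix c assume "c \<in> face d"
    then obtain m where "c = (ph ^^ m) d" unfolding face_of_def by auto
    also have "\<dots> = (ph ^^ m) ((ph ^^ n) d)" using n by simp
    also have "\<dots> = (ph ^^ m) ((ph ^^ (n - 1)) (ph d))"
      using n(1) by (metis Suc_pred' comp_apply funpow_Suc_right)
    also have "\<dots> = (ph ^^ (m + (n - 1))) (ph d)" by (simp add: funpow_add)
    finally show "c \<in> face (ph d)" by (simp add: funpow_ph_in_face)
  qed
qed

lemma face_eq: "d \<in> D \<Longrightarrow> c \<in> face d \<Longrightarrow> face c = face d"
proof -
  assume d: "d \<in> D" and "c \<in> face d"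
  then obtain n where "c = (ph ^^ n) d" unfolding face_of_def by auto
  moreover have "face ((ph ^^ n) d) = face d"
    by (induction n) (use d funpow_ph_in in auto)
  ultimately show ?thesis by simp
qed

text \<open>Since \<open>ph (si d) = alpha d\<close>, the faces of the two angles beside
  \<open>d\<close> are \<open>face d\<close> and \<open>face (alpha d)\<close>. Dual edges are
  written in this form below.\<close>

lemma face_si: "d \<in> D \<Longrightarrow> face (si d) = face (alpha d)"
  using face_ph[of "si d"] by (simp add: phi_def)

lemma vert_ph: "d \<in> D \<Longrightarrow> vert (alpha (ph d)) = vert d"
  by (simp add: phi_def)

lemma vert_edge_leaves:
  assumes "d \<in> D" "d' \<in> D" "vert d \<in> S" "vert d' \<notin> S"
  obtains e where "e \<in> D" "vert e \<in> S" "vert (alpha e) \<notin> S"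
proof -
  obtain a b where "(a, b) \<in> map_rel D alpha sigma" "vert a \<in> S" "vert b \<notin> S"
    using rtrancl_leaves_set[OF map_connected[OF assms(1,2)], of "{d. vert d \<in> S}"] assms by auto
  then show ?thesis using that by (auto simp: map_rel_def)
qed

lemma face_edge_leaves:
  assumes "d \<in> D" "d' \<in> D" "face d \<in> S" "face d' \<notin> S"
  obtains e where "e \<in> D" "face e \<in> S" "face (alpha e) \<notin> S"
proof -
  obtain a b where ab: "(a, b) \<in> map_rel D alpha sigma" "face a \<in> S" "face b \<notin> S"
    using rtrancl_leaves_set[OF map_connected[OF assms(1,2)], of "{d. face d \<in> S}"] assms by auto
  then consider "a \<in> D" "b = alpha a" | "a \<in> D" "b = sigma a" by (auto simp: map_rel_def)
  then show ?thesis
  proof cases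
    case 1 then show ?thesis using ab that by auto
  next
    case 2
    then have "face (alpha b) = face a" using face_si[of b] by simp
    then show ?thesis using ab 2 that[of "alpha b"] by simp
  qed
qed

text \<open>The walk \<open>ph\<close> around a face is closed, so it cannot change sides of
  \<open>S\<close> exactly once. If the same face lies on both sides of the edge, \<open>c\<close>
  may be \<open>alpha a\<close>.\<close>

lemma face_cut_not_single:
  assumes "a \<in> D" "(vert a \<in> S) \<noteq> (vert (alpha a) \<in> S)"
  shows "\<exists>c\<in>D. c \<noteq> a \<and> face c = face a \<and> (vert c \<in> S) \<noteq> (vert (alpha c) \<in> S)"
proof (rule ccontr)
  assume no: "\<not> ?thesis"
  have none: "(vert c \<in> S) = (vert (alpha c) \<in> S)" if "c \<in> D" "c \<noteq> a" "face c = face a" for c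
    using no that by blast
  have const: "(vert ((ph ^^ n) a) \<in> S) = (vert a \<in> S)" for n
  proof (induction n)
    case (Suc n)
    have D: "(ph ^^ n) a \<in> D" "ph ((ph ^^ n) a) \<in> D"
      using assms(1) funpow_ph_in by auto
    have "face (ph ((ph ^^ n) a)) = face a"
      using D face_eq[OF assms(1) funpow_ph_in_face, of n] by simp
    then show ?case
      using none[OF D(2)] vert_ph[OF D(1)] Suc by (cases "ph ((ph ^^ n) a) = a") auto
  qed simp
  obtain n where n: "n > 0" "(ph ^^ n) a = a"
    using finite_perm_period[OF finite_D bij_ph assms(1)] by blast
  then have "ph ((ph ^^ (n - 1)) a) = a" by (metis Suc_pred' comp_apply funpow.simps(2))
  then have "vert (alpha a) = vert ((ph ^^ (n - 1)) a)"
    using vert_ph[of "(ph ^^ (n - 1)) a"] funpow_ph_in[OF assms(1)] by metis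
  then show False using const assms(2) by metis
qed

section \<open>The dual graph and separation by closed sets of darts\<close>

definition dual_step :: "'d set \<Rightarrow> ('d set \<times> 'd set) set" where
  "dual_step C = {(face d, face (alpha d)) | d. d \<in> D \<and> d \<notin> C \<and> alpha d \<notin> C}"

lemma dual_step_sym: "(f, g) \<in> dual_step C \<Longrightarrow> (g, f) \<in> dual_step C"
  unfolding dual_step_def by (smt (verit, best) alpha_alpha alpha_in mem_Collect_eq prod.inject)

lemma card_with_alpha:
  assumes "X \<subseteq> D" "X \<inter> alpha ` X = {}"
  shows "card (X \<union> alpha ` X) = 2 * card X"
proof -
  have "finite X" using assms(1) finite_D finite_subset by blast
  then show ?thesis
    using assms card_image[OF inj_on_subset[OF inj_alpha assms(1)]]
    by (simp add: card_Un_disjoint)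
qed

text \<open>If removing the edges of C left the dual graph connected, it would have a spanning tree
  avoiding C. By Euler's formula too few further edges remain to connect every vertex to the
  vertices of C, so some cut consists of edges of the dual tree only. A dual tree edge of this cut
  farthest from the root then is the only cut edge of its face, which is impossible.\<close>

lemma closed_dart_set_separates:
  assumes f0: "f0 \<in> face ` D"
    and C: "C \<subseteq> D" "C \<noteq> {}" "C \<inter> alpha ` C = {}" "\<And>d. d \<in> C \<Longrightarrow> vert (alpha d) \<in> vert ` C"
  shows "\<exists>f\<in>face ` D. (f0, f) \<notin> (dual_step C)\<^sup>*"
proof (rule ccontr)
  assume "\<not> ?thesis"
  then have "\<And>f. f \<in> face ` D \<Longrightarrow> \<exists>u\<in>{f0}. (u, f) \<in> (dual_step C)\<^sup>*" by blast
  then obtain h :: "'d set \<Rightarrow> nat" where h: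
    "\<And>f. f \<in> face ` D \<Longrightarrow> f \<notin> {f0} \<Longrightarrow> \<exists>g. (g, f) \<in> dual_step C \<and> h g < h f"
    using reachable_rank by metis
  \<comment> \<open>The dual spanning tree: \<open>e f\<close> is the dart on the parent side of the
    tree edge above \<open>f\<close>, and \<open>alpha (e f)\<close> lies on the side of
    \<open>f\<close>.\<close>
  have "\<forall>f\<in>face ` D - {f0}. \<exists>d. d \<in> D \<and> d \<notin> C \<and> alpha d \<notin> C \<and> face (alpha d) = f \<and> h (face d) < h f"
    using h unfolding dual_step_def by fastforce
  then obtain e where e: "\<And>f. f \<in> face ` D - {f0} \<Longrightarrow>
      e f \<in> D \<and> e f \<notin> C \<and> alpha (e f) \<notin> C \<and> face (alpha (e f)) = f \<and> h (face (e f)) < h f"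
    by metis
  define T where "T = e ` (face ` D - {f0})"
  have T: "T \<subseteq> D" using e unfolding T_def by auto
  have "inj_on e (face ` D - {f0})" by (metis e inj_onI)
  then have cardT: "card T = card (face ` D) - 1"
    unfolding T_def using f0 by (simp add: card_image)
  \<comment> \<open>Otherwise \<open>f\<close> and \<open>g\<close> would be parents of each other,
    and the rank would decrease in both directions.\<close>
  have "e f \<noteq> alpha (e g)" if "f \<in> face ` D - {f0}" "g \<in> face ` D - {f0}" for f g
    using e[OF that(1)] e[OF that(2)] by (metis alpha_alpha less_asym)
  then have Tdisj: "T \<inter> alpha ` T = {}" unfolding T_def by blast
  define E where "E = D - (T \<union> alpha ` T) - (C \<union> alpha ` C)"
  have E_alpha: "alpha d \<in> E" if "d \<in> E" for d
    using that C(1) T unfolding E_def by (auto simp: image_iff subset_iff) (metis alpha_alpha)+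
  define R where "R = {(vert d, vert (alpha d)) | d. d \<in> E}"
  define S where "S = {v. \<exists>u\<in>vert ` C. (u, v) \<in> R\<^sup>*}"
  have US: "vert ` C \<subseteq> S" unfolding S_def by blast
  \<comment> \<open>If the edges of \<open>E\<close> joined every vertex to \<open>C\<close>, a
    forest \<open>P\<close> would use one edge per vertex outside \<open>C\<close>. As
    \<open>C\<close> has at least as many edges as tails, \<open>T\<close>, \<open>P\<close> and
    \<open>C\<close> would together have at least V + F - 1 edges, one more than Euler's formula
    allows.\<close>
  have "\<not> vert ` D \<subseteq> S"
  proof
    assume "vert ` D \<subseteq> S"
    then have "\<And>v. v \<in> vert ` D \<Longrightarrow> \<exists>u\<in>vert ` C. (u, v) \<in> R\<^sup>*" unfolding S_def by blast
    then obtain k :: "'v \<Rightarrow> nat" where k: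
      "\<And>v. v \<in> vert ` D \<Longrightarrow> v \<notin> vert ` C \<Longrightarrow> \<exists>u. (u, v) \<in> R \<and> k u < k v"
      using reachable_rank by metis
    have "\<forall>v\<in>vert ` D - vert ` C. \<exists>d. d \<in> E \<and> vert (alpha d) = v \<and> k (vert d) < k v"
      using k unfolding R_def by fastforce
    then obtain p where p: "\<And>v. v \<in> vert ` D - vert ` C \<Longrightarrow>
        p v \<in> E \<and> vert (alpha (p v)) = v \<and> k (vert (p v)) < k v"
      by metis
    define P where "P = p ` (vert ` D - vert ` C)"
    have P: "P \<subseteq> E" "P \<subseteq> D" using p unfolding P_def E_def by auto
    have "inj_on p (vert ` D - vert ` C)" by (metis p inj_onI)
    then have cardP: "card P = card (vert ` D) - card (vert ` C)"
      unfolding P_def using C(1)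
      by (simp add: card_image card_Diff_subset finite_subset[OF C(1)] image_mono)
    have "p v \<noteq> alpha (p w)" if "v \<in> vert ` D - vert ` C" "w \<in> vert ` D - vert ` C" for v w
      using p[OF that(1)] p[OF that(2)] unfolding E_def by (metis DiffE alpha_alpha less_asym)
    then have Pdisj: "P \<inter> alpha ` P = {}" unfolding P_def by blast
    let ?A = "T \<union> alpha ` T" and ?B = "P \<union> alpha ` P" and ?C = "C \<union> alpha ` C"
    have "?B \<subseteq> E" using P E_alpha by auto
    then have "?B \<inter> ?A = {}" "?B \<inter> ?C = {}" unfolding E_def by auto
    moreover have "?A \<inter> ?C = {}"
    proof -
      have "T \<inter> C = {}" "alpha ` T \<inter> C = {}" using e unfolding T_def by auto
      moreover have "T \<inter> alpha ` C = {}" "alpha ` T \<inter> alpha ` C = {}"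
        using calculation T C(1) by (auto simp: subset_iff) (metis IntI alpha_alpha empty_iff imageI)+
      ultimately show ?thesis by blast
    qed
    moreover have sub: "?A \<union> ?B \<union> ?C \<subseteq> D"
      using T P C(1) alpha_image_subset by auto
    moreover have "finite ?A" "finite ?B" "finite ?C"
      using sub finite_subset[OF _ finite_D] by blast+
    ultimately have "card (?A \<union> ?B \<union> ?C) = card ?A + card ?B + card ?C"
      by (subst card_Un_disjoint; (subst card_Un_disjoint)?) auto
    then have "2 * card T + 2 * card P + 2 * card C \<le> card D"
      using card_mono[OF finite_D sub] card_with_alpha[OF T Tdisj]
        card_with_alpha[OF P(2) Pdisj] card_with_alpha[OF C(1,3)] by simp
    moreover have "card (vert ` C) \<le> card C"
      using C(1) finite_D finite_subset card_image_le by metis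
    moreover have "card (vert ` C) \<le> card (vert ` D)"
      using C(1) by (simp add: card_mono image_mono)
    moreover have "card (face ` D) > 0" using f0 by (auto simp: card_gt_0_iff)
    moreover have "card T + 1 = card (face ` D)" using cardT calculation(4) by simp
    moreover have "card P + card (vert ` C) = card (vert ` D)" using cardP calculation(3) by simp
    moreover have "card D + 4 = 2 * card (vert ` D) + 2 * card (face ` D)" using euler by simp
    ultimately show False by linarith
  qed
  then obtain d d' where "d \<in> D" "d' \<in> D" "vert d \<in> S" "vert d' \<notin> S"
    using C(1,2) US by blast
  then obtain x where x: "x \<in> D" "vert x \<in> S" "vert (alpha x) \<notin> S"
    by (rule vert_edge_leaves)
  \<comment> \<open>The darts crossing the cut. Edges of \<open>C\<close> have both ends in
    \<open>S\<close> and edges of \<open>E\<close> never leave \<open>S\<close>, so only edges of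
    the dual tree cross it.\<close>
  define X where "X = {d\<in>D. (vert d \<in> S) \<noteq> (vert (alpha d) \<in> S)}"
  have X_alpha: "alpha d \<in> X" if "d \<in> X" for d using that unfolding X_def by auto
  have X_T: "d \<in> T \<union> alpha ` T" if "d \<in> X" for d
  proof (rule ccontr)
    assume nT: "d \<notin> T \<union> alpha ` T"
    have dC: "d \<notin> C" using that C(4) US unfolding X_def by blast
    have "alpha d \<notin> C" using X_alpha[OF that] C(4) US unfolding X_def by blast
    then have "d \<in> E" using that nT dC C(1) unfolding E_def X_def by (auto simp: subset_iff)
    moreover have "alpha (alpha d) = d" using that unfolding X_def by simp
    ultimately have "(vert d, vert (alpha d)) \<in> R" "(vert (alpha d), vert d) \<in> R"
      unfolding R_def using E_alpha[of d] by force+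
    then have "vert d \<in> S \<longleftrightarrow> vert (alpha d) \<in> S"
      unfolding S_def by (blast intro: rtrancl_into_rtrancl)
    then show False using that unfolding X_def by simp
  qed
  define M where "M = {f \<in> face ` D - {f0}. e f \<in> X}"
  have "x \<in> X" using x unfolding X_def by simp
  then obtain f1 where "f1 \<in> M"
    using X_T[of x] X_alpha[of x] e unfolding T_def M_def by fastforce
  moreover have "finite M" unfolding M_def by simp
  ultimately have "Max (h ` M) \<in> h ` M" "\<And>g. g \<in> M \<Longrightarrow> h g \<le> Max (h ` M)"
    by (auto intro!: Max_in)
  then obtain f where f: "f \<in> M" "\<And>g. g \<in> M \<Longrightarrow> h g \<le> h f" by auto
  then have ef: "e f \<in> X" "f \<in> face ` D - {f0}" unfolding M_def by auto
  define a where "a = alpha (e f)"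
  have a: "a \<in> D" "face a = f" "(vert a \<in> S) \<noteq> (vert (alpha a) \<in> S)"
    using X_alpha[OF ef(1)] e[OF ef(2)] unfolding a_def X_def by auto
  obtain c where c: "c \<in> D" "c \<noteq> a" "face c = f" "c \<in> X"
    using face_cut_not_single[OF a(1,3)] a(2) unfolding X_def by blast
  \<comment> \<open>A further cut edge of the face \<open>f\<close> would either lead to a child of
    \<open>f\<close>, whose rank exceeds the maximum, or be the parent edge of \<open>f\<close>,
    which is \<open>a\<close> itself.\<close>
  from X_T[OF c(4)] show False
  proof
    assume "c \<in> T"
    then obtain g where g: "g \<in> face ` D - {f0}" "c = e g" unfolding T_def by blast
    then have "h f < h g" using e[OF g(1)] c by simp
    then show False using f(2)[of g] g c unfolding M_def by auto
  next
    assume "c \<in> alpha ` T"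
    then obtain g where g: "g \<in> face ` D - {f0}" "c = alpha (e g)" unfolding T_def by blast
    then show False using e[OF g(1)] c unfolding a_def by auto
  qed
qed

end

section \<open>Strong labelings as alternating labelings\<close>

locale coloured_quadrangulation =
  fixes D :: "'d set" and alpha sigma :: "'d \<Rightarrow> 'd" and vert :: "'d \<Rightarrow> 'v"
    and outer :: 'd and black :: "'v \<Rightarrow> bool" and s0 s1 :: 'v
  assumes quad: "quadrangulation D alpha sigma vert"
    and outer: "outer \<in> D"
    and colouring: "proper_bw_coloring D alpha vert black"
    and s: "s0 \<noteq> s1" "black s0" "black s1"
    and s0_outer: "s0 \<in> vert ` face_of alpha sigma outer"
    and s1_outer: "s1 \<in> vert ` face_of alpha sigma outer"

sublocale coloured_quadrangulation \<subseteq> plane_rotation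
  using quad unfolding quadrangulation_def by unfold_locales blast

context coloured_quadrangulation
begin

lemma face_card: "d \<in> D \<Longrightarrow> card (face d) = 4"
  using quad unfolding quadrangulation_def by blast

lemma face_cycle:
  assumes "d \<in> D"
  shows "ph (ph (ph (ph d))) = d" and "face d = {d, ph d, ph (ph d), ph (ph (ph d))}"
proof -
  have fin: "finite (face d)" using face_subset[OF assms] finite_D finite_subset by blast
  have sub: "ph ` face d \<subseteq> face d"
  proof
    fix x assume "x \<in> ph ` face d"
    then obtain n where "x = ph ((ph ^^ n) d)" unfolding face_of_def by auto
    then have "x = (ph ^^ Suc n) d" by simp
    then show "x \<in> face d" by (metis funpow_ph_in_face)
  qed
  have inj: "inj_on ph (face d)"
    using bij_ph face_subset[OF assms] by (meson bij_betw_imp_inj_on inj_on_subset)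
  have bij: "bij_betw ph (face d) (face d)"
    using endo_inj_surj[OF fin sub inj] inj by (simp add: bij_betw_def)
  have tr: "\<exists>n. (ph ^^ n) d = y" if "y \<in> face d" for y
    using that unfolding face_of_def by auto
  note cyc = transitive_perm_cycle[OF fin bij self_in_face tr, unfolded face_card[OF assms]]
  show "ph (ph (ph (ph d))) = d" using cyc(1) by (simp add: eval_nat_numeral)
  have "{..<4} = {0, 1, 2, 3::nat}" by auto
  then show "face d = {d, ph d, ph (ph d), ph (ph (ph d))}"
    using cyc(2) by (simp add: eval_nat_numeral)
qed

lemma black_alpha: "d \<in> D \<Longrightarrow> black (vert (alpha d)) \<longleftrightarrow> \<not> black (vert d)"
  using colouring unfolding proper_bw_coloring_def by blast

lemma black_ph: "d \<in> D \<Longrightarrow> black (vert (ph d)) \<longleftrightarrow> \<not> black (vert d)"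
  using black_alpha[of "ph d"] vert_ph by auto

lemma special_in: "s0 \<in> vert ` D" "s1 \<in> vert ` D"
  using s0_outer s1_outer face_subset[OF outer] by auto

definition binary_at_vertices :: "('d \<Rightarrow> nat) \<Rightarrow> bool" where
  "binary_at_vertices lab \<longleftrightarrow>
     lab \<in> D \<rightarrow>\<^sub>E {0, 1} \<and>
     (\<forall>d\<in>D. (vert d = s0 \<longrightarrow> lab d = 0) \<and> (vert d = s1 \<longrightarrow> lab d = 1)) \<and>
     (\<forall>v\<in>vert ` D. v \<notin> {s0, s1} \<longrightarrow>
        {d\<in>D. vert d = v \<and> lab d = 1} \<noteq> {} \<and> {d\<in>D. vert d = v \<and> lab d = 0} \<noteq> {} \<and>
        cyc_interval sigma {d\<in>D. vert d = v \<and> lab d = 1} \<and>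
        cyc_interval sigma {d\<in>D. vert d = v \<and> lab d = 0})"

definition alternating :: "('d \<Rightarrow> nat) \<Rightarrow> bool" where
  "alternating lab \<longleftrightarrow> (\<forall>d\<in>D. (lab d = lab (ph d)) \<longleftrightarrow> black (vert d))"

lemma binary_values: "binary_at_vertices lab \<Longrightarrow> d \<in> D \<Longrightarrow> lab d = 0 \<or> lab d = 1"
  unfolding binary_at_vertices_def by auto

lemma alternating_si:
  assumes "alternating lab" "d \<in> D"
  shows "lab (si d) = lab (alpha d) \<longleftrightarrow> black (vert d)"
  using assms unfolding alternating_def by (metis phi_def si_in sigma_si vert_si)

text \<open>Going around the four angles of an edge, a binary label changes an even number of times.
  With \<open>p\<close>, \<open>q\<close> at one end and \<open>r\<close>, \<open>t\<close> at the
  other, the left side is (G2); the right side compares labels along the two faces, so it links the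
  face rules on both sides of the edge.\<close>

lemma binary_edge_parity:
  fixes p q r t :: nat
  assumes "p \<in> {0, 1}" "q \<in> {0, 1}" "r \<in> {0, 1}" "t \<in> {0, 1}"
  shows "((p = q) \<noteq> (r = t)) \<longleftrightarrow> ((q = r) \<noteq> (t = p))"
  using assms by auto

lemma alternating_edge:
  assumes "binary_at_vertices lab" "alternating lab" "d \<in> D"
  shows "(lab d = lab (si d)) \<noteq> (lab (alpha d) = lab (si (alpha d)))"
proof -
  have "lab x \<in> {0, 1}" if "x \<in> D" for x using binary_values[OF assms(1) that] by auto
  then show ?thesis
    using alternating_si[OF assms(2,3)] alternating_si[OF assms(2), of "alpha d"] assms(3)
      black_alpha[OF assms(3)]
      binary_edge_parity[of "lab d" "lab (si d)" "lab (alpha d)" "lab (si (alpha d))"]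
    by auto
qed

text \<open>From left to right, the rule \<open>good\<close> holds at \<open>s0\<close> in the outer
  face, continues around each face by (G3) and across each edge by (G2), and reaches every dart by
  connectedness. From right to left, the rule forces 0,0,1,1 from any black angle labelled
  0.\<close>

lemma strong_labeling_iff:
  "strong_labeling D alpha sigma vert outer s0 s1 lab \<longleftrightarrow>
     binary_at_vertices lab \<and> alternating lab"
proof
  assume L: "strong_labeling D alpha sigma vert outer s0 s1 lab"
  then have bin: "binary_at_vertices lab"
    unfolding strong_labeling_def binary_at_vertices_def by blast
  have G2: "(lab d = lab (si d)) \<noteq> (lab (alpha d) = lab (si (alpha d)))" if "d \<in> D" for d
    using L that unfolding strong_labeling_def by blast
  obtain c0 where c0: "c0 \<in> face outer" "vert c0 = s0" "lab c0 = 0" "lab (ph c0) = 0"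
      "lab ((ph ^^ 2) c0) = 1" "lab ((ph ^^ 3) c0) = 1"
    using L unfolding strong_labeling_def by blast
  have c0D: "c0 \<in> D" using c0(1) face_subset[OF outer] by auto
  \<comment> \<open>In the cyclic pattern 0,0,1,1 coincidences and changes of consecutive labels
    alternate, just as the vertex colours do.\<close>
  have flip: "(lab (ph d) = lab (ph (ph d))) \<noteq> (lab d = lab (ph d))" if d: "d \<in> D" for d
  proof -
    have "\<exists>c\<in>face d. lab c = 0 \<and> lab (ph c) = 0 \<and> lab ((ph ^^ 2) c) = 1 \<and> lab ((ph ^^ 3) c) = 1"
      using L c0 that unfolding strong_labeling_def by (cases "face d = face outer") auto
    then obtain c where c: "c \<in> face d" "lab c = 0" "lab (ph c) = 0"
        "lab (ph (ph c)) = 1" "lab (ph (ph (ph c))) = 1"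
      by (auto simp: eval_nat_numeral)
    have cD: "c \<in> D" using c(1) face_subset[OF d] by auto
    have "d \<in> face c" using face_eq[OF d c(1)] by simp
    then show ?thesis using face_cycle[OF cD] c by auto
  qed
  define good where "good d \<longleftrightarrow> ((lab d = lab (ph d)) \<longleftrightarrow> black (vert d))" for d
  have good_ph: "good (ph d)" if "good d" "d \<in> D" for d
    using that flip[of d] black_ph[of d] unfolding good_def by auto
  have good_cross: "good (si (alpha d)) \<longleftrightarrow> good (si d)" if d: "d \<in> D" for d
  proof -
    have "lab x \<in> {0, 1}" if "x \<in> D" for x using binary_values[OF bin that] by auto
    then show ?thesis
      using G2[OF d] d black_alpha[OF d]
        binary_edge_parity[of "lab d" "lab (si d)" "lab (alpha d)" "lab (si (alpha d))"]
      unfolding good_def phi_def by auto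
  qed
  have good_sigma: "good (sigma d)" if "good d" "d \<in> D" for d
  proof -
    \<comment> \<open>The edge of \<open>sigma d\<close> separates the angles \<open>d\<close> and
      \<open>sigma d\<close>: cross it from \<open>d\<close>, then one step of \<open>ph\<close>
      arrives at \<open>sigma d\<close>.\<close>
    have "good (si (alpha (sigma d)))" using good_cross[of "sigma d"] that by simp
    then have "good (ph (si (alpha (sigma d))))" using good_ph that by simp
    then show ?thesis using that by (simp add: phi_def)
  qed
  have good_si: "good (si d)" if d: "good d" "d \<in> D" for d
  proof -
    obtain n where "(sigma ^^ n) d = si d" using sigma_transitive[of d "si d"] d by auto
    moreover have "good ((sigma ^^ n) d) \<and> (sigma ^^ n) d \<in> D" for n
      by (induction n) (use d good_sigma in auto)
    ultimately show ?thesis by metis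
  qed
  have good_alpha: "good (alpha d)" if "good d" "d \<in> D" for d
    using good_sigma[of "si (alpha d)"] good_cross[of d] good_si[of d] that by simp
  have "good c0" unfolding good_def using c0 s by simp
  have "good d" if "d \<in> D" for d
    using map_connected[OF c0D that]
  proof (induction rule: rtrancl_induct)
    case (step a b)
    then show ?case using good_alpha good_sigma by (auto simp: map_rel_def)
  qed fact
  then show "binary_at_vertices lab \<and> alternating lab"
    using bin unfolding alternating_def good_def by blast
next
  assume L: "binary_at_vertices lab \<and> alternating lab"
  then have alt: "lab d = lab (ph d) \<longleftrightarrow> black (vert d)" if "d \<in> D" for d
    using that unfolding alternating_def by blast
  have val: "lab d = 0 \<or> lab d = 1" if "d \<in> D" for d using binary_values L that by blast
  have pattern: "lab (ph c) = 0 \<and> lab ((ph ^^ 2) c) = 1 \<and> lab ((ph ^^ 3) c) = 1"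
    if "c \<in> D" "black (vert c)" "lab c = 0" for c
    using that alt[of c] alt[of "ph c"] alt[of "ph (ph c)"] black_ph[of c] black_ph[of "ph c"]
      val[of "ph (ph c)"]
    by (simp add: eval_nat_numeral)
  have G3: "\<exists>c\<in>face d. lab c = 0 \<and> lab (ph c) = 0 \<and> lab ((ph ^^ 2) c) = 1 \<and> lab ((ph ^^ 3) c) = 1"
    if d: "d \<in> D" for d
  proof -
    \<comment> \<open>The two black angles of the face are \<open>b\<close> and
      \<open>ph (ph b)\<close>. Exactly one label change lies between them, so one of them has label
      0 and starts the pattern.\<close>
    define b where "b = (if black (vert d) then d else ph d)"
    have b: "b \<in> D" "black (vert b)" using d black_ph[of d] unfolding b_def by auto
    have bf: "b \<in> face d" "ph (ph b) \<in> face d"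
      using face_cycle[OF d] unfolding b_def by auto
    have b2: "ph (ph b) \<in> D" "black (vert (ph (ph b)))" using b black_ph by auto
    have "lab b = lab (ph b)" "lab (ph b) \<noteq> lab (ph (ph b))"
      using alt[of b] alt[of "ph b"] b black_ph[of b] ph_in[of b] by blast+
    then have "lab b = 0 \<or> lab (ph (ph b)) = 0"
      using val[OF b(1)] val[OF b2(1)] by metis
    then show ?thesis using pattern b b2 bf by blast
  qed
  obtain c0 where c0: "c0 \<in> face outer" "vert c0 = s0" using s0_outer by auto
  have c0D: "c0 \<in> D" using c0 face_subset[OF outer] by auto
  have "lab c0 = 0" using L c0 c0D unfolding binary_at_vertices_def by blast
  then have G3_outer: "\<exists>c\<in>face outer. vert c = s0 \<and> lab c = 0 \<and> lab (ph c) = 0 \<and>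
            lab ((ph ^^ 2) c) = 1 \<and> lab ((ph ^^ 3) c) = 1"
    using pattern[OF c0D] c0 s by auto
  have G2: "\<forall>d\<in>D. (lab d = lab (si d)) \<noteq> (lab (alpha d) = lab (si (alpha d)))"
    using L alternating_edge by blast
  note G01 = L[THEN conjunct1, unfolded binary_at_vertices_def]
  show "strong_labeling D alpha sigma vert outer s0 s1 lab"
    unfolding strong_labeling_def
    by (intro conjI G2 G3_outer G01[THEN conjunct1] G01[THEN conjunct2, THEN conjunct1]
        G01[THEN conjunct2, THEN conjunct2]) (use G3 in blast)
qed

section \<open>Rotation at a vertex and the matching of angles with darts\<close>

definition rot :: "'v \<Rightarrow> 'd \<Rightarrow> 'd" where
  "rot v = (if black v then sigma else si)"

abbreviation star :: "'v \<Rightarrow> 'd set" where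
  "star v \<equiv> {d\<in>D. vert d = v}"

text \<open>The two angles at the tail of a dart, in the order in which the rotation rot passes them,
  and conversely the dart whose first angle is a given one.\<close>

definition before :: "'d \<Rightarrow> 'd" where
  "before d = (if black (vert d) then si d else d)"

definition after :: "'d \<Rightarrow> 'd" where
  "after d = (if black (vert d) then d else si d)"

definition after_angle :: "'d \<Rightarrow> 'd" where
  "after_angle x = (if black (vert x) then sigma x else x)"

lemma rot_in [simp]: "x \<in> D \<Longrightarrow> rot v x \<in> D" "x \<in> D \<Longrightarrow> vert (rot v x) = vert x"
  unfolding rot_def by auto

lemma funpow_rot_in [simp]:
  assumes "x \<in> D" shows "(rot v ^^ n) x \<in> D" "vert ((rot v ^^ n) x) = vert x"
  by (induction n) (use assms in auto)

lemma before_in [simp]: "d \<in> D \<Longrightarrow> before d \<in> D" "d \<in> D \<Longrightarrow> vert (before d) = vert d"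
  unfolding before_def by auto

lemma after_angle_in [simp]:
  "x \<in> D \<Longrightarrow> after_angle x \<in> D" "x \<in> D \<Longrightarrow> vert (after_angle x) = vert x"
  unfolding after_angle_def by auto

lemma rot_before: "d \<in> D \<Longrightarrow> rot (vert d) (before d) = after d"
  unfolding rot_def before_def after_def by auto

lemma after_angle_before: "d \<in> D \<Longrightarrow> after_angle (before d) = d"
  unfolding before_def after_angle_def by auto

lemma before_after_angle: "x \<in> D \<Longrightarrow> before (after_angle x) = x"
  unfolding before_def after_angle_def by auto

text \<open>At a fixed vertex \<open>after_angle\<close> is \<open>sigma\<close> or the identity,
  and so commutes with the rotation. Hence angles and darts can be numbered by the same
  index.\<close>

lemma funpow_rot_after_angle:
  "z \<in> D \<Longrightarrow> (rot (vert z) ^^ j) (after_angle z) = after_angle ((rot (vert z) ^^ j) z)"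
  by (auto simp: after_angle_def rot_def funpow_swap1 simp del: funpow_rot_in)
    (metis funpow_rot_in(2) rot_def)+

lemma rot_inverse:
  assumes "x \<in> D"
  shows "(if black v then si else sigma) (rot v x) = x" "rot v ((if black v then si else sigma) x) = x"
  using assms unfolding rot_def by auto

lemma bij_rot: "bij_betw (rot v) (star v) (star v)"
  by (rule bij_betw_byWitness[where f' = "if black v then si else sigma"])
    (use rot_inverse[of _ v] in \<open>auto split: if_splits\<close>)

text \<open>At a white vertex, a \<open>sigma\<close> walk from \<open>y\<close> to \<open>x\<close>
  is inverted step by step.\<close>

lemma rot_transitive:
  assumes "x \<in> star v" "y \<in> star v"
  shows "\<exists>n. (rot v ^^ n) x = y"
proof -
  obtain m where m: "(sigma ^^ m) x = y" using sigma_transitive[of x y] assms by auto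
  obtain n where n: "(sigma ^^ n) y = x" using sigma_transitive[of y x] assms by auto
  have D: "(sigma ^^ n) y \<in> D" for n by (induction n) (use assms in auto)
  have "(si ^^ n) ((sigma ^^ n) y) = y" for n
  proof (induction n)
    case (Suc n)
    have "(si ^^ Suc n) ((sigma ^^ Suc n) y) = (si ^^ n) (si ((sigma ^^ Suc n) y))"
      by (rule funpow_Suc_right[THEN fun_cong, unfolded comp_apply])
    then show ?case using Suc D[of n] by simp
  qed simp
  then have "(si ^^ n) x = y" using n by metis
  then show ?thesis using m unfolding rot_def by auto
qed

lemma rot_cycle:
  assumes "z \<in> star v"
  shows "(rot v ^^ card (star v)) z = z"
    and "star v = (\<lambda>j. (rot v ^^ j) z) ` {..<card (star v)}"
    and "inj_on (\<lambda>j. (rot v ^^ j) z) {..<card (star v)}"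
  using transitive_perm_cycle[OF _ bij_rot assms rot_transitive[OF assms]] finite_D by auto

lemma cyc_interval_rot_iff:
  assumes "S \<subseteq> D"
  shows "cyc_interval (rot v) S \<longleftrightarrow> cyc_interval sigma S"
  using cyc_interval_inverse[of D sigma si S] cyc_interval_inverse[of D si sigma S] assms
  unfolding rot_def by auto

section \<open>From labelings to decompositions\<close>

text \<open>For the labelings considered the two labels at the head coincide, so either of them
  could name the colour.\<close>

definition arcs :: "('d \<Rightarrow> nat) \<Rightarrow> nat \<Rightarrow> 'd set" where
  "arcs lab i = {d\<in>D. lab (si d) \<noteq> lab d \<and> lab (alpha d) = i}"

definition sink :: "nat \<Rightarrow> 'v" where
  "sink i = (if i = 0 then s0 else s1)"

context
  fixes lab assumes bin: "binary_at_vertices lab" and alt: "alternating lab"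
begin

text \<open>The face rule gives \<open>before d\<close> the same label as the angle of its face at
  the other end of the edge. So this label is the colour of the edge in either orientation, and a
  label change across \<open>d\<close> decides that \<open>d\<close> points outward.\<close>

lemma arcs_iff:
  assumes d: "d \<in> D"
  shows "d \<in> arcs lab i \<longleftrightarrow> lab (before d) = i \<and> lab (after d) \<noteq> lab (before d)"
    and "alpha d \<in> arcs lab i \<longleftrightarrow> lab (before d) = i \<and> lab (after d) = lab (before d)"
proof -
  have val: "lab x = 0 \<or> lab x = 1" if "x \<in> D" for x using binary_values[OF bin that] .
  note facts = val[OF d] val[of "si d"] val[of "alpha d"] val[of "si (alpha d)"]
    alternating_si[OF alt d] alternating_si[OF alt, of "alpha d"] black_alpha[OF d]
  show "d \<in> arcs lab i \<longleftrightarrow> lab (before d) = i \<and> lab (after d) \<noteq> lab (before d)"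
    using facts d unfolding arcs_def before_def after_def by auto
  show "alpha d \<in> arcs lab i \<longleftrightarrow> lab (before d) = i \<and> lab (after d) = lab (before d)"
    using facts d unfolding arcs_def before_def after_def by auto
qed

lemma arcs_disjoint: "d \<in> arcs lab i \<Longrightarrow> d \<in> arcs lab j \<Longrightarrow> i = j"
  unfolding arcs_def by auto

lemma arcs_oriented: "d \<in> arcs lab i \<Longrightarrow> alpha d \<notin> arcs lab j"
  using arcs_iff[of d] unfolding arcs_def by blast

lemma arcs_in: "d \<in> arcs lab i \<Longrightarrow> d \<in> D"
  unfolding arcs_def by auto

lemma arcs_tail: "d \<in> arcs lab i \<Longrightarrow> vert d \<notin> {s0, s1}"
  using bin unfolding arcs_def binary_at_vertices_def by auto

lemma special_labels: "d \<in> D \<Longrightarrow> vert d = s0 \<Longrightarrow> lab d = 0" "d \<in> D \<Longrightarrow> vert d = s1 \<Longrightarrow> lab d = 1"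
  using bin unfolding binary_at_vertices_def by auto

text \<open>The rotation is started at the first angle of the interval of 0s. As some angle has
  label 1, this interval ends before a full turn.\<close>

lemma vertex_intervals:
  assumes "v \<in> vert ` D" "v \<notin> {s0, s1}"
  obtains z k where "z \<in> star v" "0 < k" "k < card (star v)"
    "\<And>j. j < card (star v) \<Longrightarrow> lab ((rot v ^^ j) z) = (if j < k then 0 else 1)"
proof -
  let ?Z = "{d\<in>D. vert d = v \<and> lab d = 0}"
  have ne: "?Z \<noteq> {}" "{d\<in>D. vert d = v \<and> lab d = 1} \<noteq> {}" and "cyc_interval sigma ?Z"
    using bin assms unfolding binary_at_vertices_def by auto
  then have "cyc_interval (rot v) ?Z" using cyc_interval_rot_iff[of ?Z] by auto
  then obtain z k where zk: "?Z = {(rot v ^^ i) z | i. i < k}" unfolding cyc_interval_def by blast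
  have k: "k > 0" using ne(1) zk by auto
  then have "z \<in> {(rot v ^^ i) z | i. i < k}" by (auto intro: exI[of _ 0])
  then have "z \<in> ?Z" using zk by simp
  then have z: "z \<in> star v" by simp
  note cyc = rot_cycle[OF z]
  have kn: "k < card (star v)"
  proof (rule ccontr)
    assume "\<not> k < card (star v)"
    then have "star v \<subseteq> {(rot v ^^ i) z | i. i < k}" by (subst cyc(2)) auto
    then have "star v \<subseteq> ?Z" using zk by simp
    then show False using ne(2) by fastforce
  qed
  have "lab ((rot v ^^ j) z) = (if j < k then 0 else 1)" if j: "j < card (star v)" for j
  proof (cases "j < k")
    case True
    then have "(rot v ^^ j) z \<in> ?Z" using zk by auto
    then show ?thesis using True by simp
  next
    case False
    have "(rot v ^^ j) z \<notin> ?Z"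
    proof
      assume "(rot v ^^ j) z \<in> ?Z"
      then obtain i where "i < k" "(rot v ^^ j) z = (rot v ^^ i) z" using zk by auto
      then show False using inj_onD[OF cyc(3), of j i] j kn False by auto
    qed
    then show ?thesis using binary_values[OF bin, of "(rot v ^^ j) z"] z False by auto
  qed
  then show ?thesis using that z k kn by blast
qed

lemma card_out_arcs:
  assumes "v \<in> vert ` D" "v \<notin> {s0, s1}" "i \<in> {0, 1}"
  shows "card {d\<in>arcs lab i. vert d = v} = 1"
proof -
  obtain z k where z: "z \<in> star v" "0 < k" "k < card (star v)"
    "\<And>j. j < card (star v) \<Longrightarrow> lab ((rot v ^^ j) z) = (if j < k then 0 else 1)"
    by (rule vertex_intervals[OF assms(1,2)]) (rule that)
  define n where "n = card (star v)"
  \<comment> \<open>The position of the last angle labelled \<open>i\<close>; the dart after it is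
    where the label changes. For \<open>i = 1\<close> this is position \<open>n - 1\<close>, after
    which the rotation wraps around to \<open>z\<close> with label 0.\<close>
  define m where "m = (if i = 0 then k - 1 else n - 1)"
  note cyc = rot_cycle[OF z(1), folded n_def]
  have lab_Suc: "lab ((rot v ^^ Suc j) z) = (if Suc j < k \<or> Suc j = n then 0 else 1)" if "j < n" for j
    using that z(4)[of "Suc j"] z(4)[of 0] z(2,3) cyc(1) unfolding n_def[symmetric]
    by (cases "Suc j = n") auto
  have arc: "d \<in> arcs lab i \<longleftrightarrow> j = m" if "d \<in> star v" "before d = (rot v ^^ j) z" "j < n" for d j
  proof -
    have "after d = (rot v ^^ Suc j) z" using rot_before[of d] that by simp
    then have a: "lab (after d) = (if Suc j < k \<or> Suc j = n then 0 else 1)"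
      using lab_Suc[OF that(3)] by simp
    have b: "lab (before d) = (if j < k then 0 else 1)"
      using z(4)[of j] that unfolding n_def by simp
    have "d \<in> arcs lab i \<longleftrightarrow> lab (before d) = i \<and> lab (after d) \<noteq> lab (before d)"
      using arcs_iff(1)[of d i] that(1) by simp
    then show ?thesis
      unfolding a b m_def using assms(3) that(3) z(2,3)[folded n_def] by (auto split: if_splits)
  qed
  have "{d\<in>arcs lab i. vert d = v} = {after_angle ((rot v ^^ m) z)}"
  proof (intro equalityI subsetI)
    fix d assume d: "d \<in> {d\<in>arcs lab i. vert d = v}"
    then have dv: "d \<in> star v" using arcs_in by blast
    then have "before d \<in> star v" by auto
    then obtain j where j: "j < n" "before d = (rot v ^^ j) z" using cyc(2) by auto
    then show "d \<in> {after_angle ((rot v ^^ m) z)}"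
      using arc[OF dv j(2,1)] d dv after_angle_before[of d] by auto
  next
    fix d assume "d \<in> {after_angle ((rot v ^^ m) z)}"
    then have "d \<in> star v" "before d = (rot v ^^ m) z"
      using z(1) by (auto simp: before_after_angle)
    moreover have "m < n" using z(2,3) unfolding m_def n_def by auto
    ultimately show "d \<in> {d\<in>arcs lab i. vert d = v}" using arc by blast
  qed
  then show ?thesis by simp
qed

section \<open>Faces cut off from the outer face, and acyclicity of each colour\<close>

definition unreached :: "'d set \<Rightarrow> 'd set set" where
  "unreached C = {f\<in>face ` D. (face outer, f) \<notin> (dual_step C)\<^sup>*}"

lemma outer_reached: "face outer \<notin> unreached C"
  unfolding unreached_def by auto

lemma unreached_cross:
  assumes "d \<in> D" "d \<notin> C" "alpha d \<notin> C"
  shows "face d \<in> unreached C \<longleftrightarrow> face (alpha d) \<in> unreached C"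
proof -
  have "(face d, face (alpha d)) \<in> dual_step C" unfolding dual_step_def using assms by blast
  moreover from this have "(face (alpha d), face d) \<in> dual_step C" by (rule dual_step_sym)
  ultimately show ?thesis
    unfolding unreached_def using assms(1) by (auto intro: rtrancl_into_rtrancl)
qed

text \<open>The angles labelled j at a vertex are separated only by edges of colour j.\<close>

lemma same_label_same_side:
  assumes C: "C \<subseteq> arcs lab i" and ij: "i \<in> {0, 1}" "j = 1 - i"
    and d: "d \<in> D" "d' \<in> D" "vert d = vert d'" "lab d = j" "lab d' = j"
  shows "face d \<in> unreached C \<longleftrightarrow> face d' \<in> unreached C"
proof -
  define S where "S = {x\<in>D. vert x = vert d \<and> lab x = j}"
  have "cyc_interval sigma S"
  proof (cases "vert d \<in> {s0, s1}")
    case True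
    \<comment> \<open>At a special vertex all angles carry one label, so the interval is a full
      turn.\<close>
    then have S: "S = star (vert d)" and b: "black (vert d)"
      using special_labels d ij s unfolding S_def by auto
    have "star (vert d) = {(sigma ^^ i) d | i. i < card (star (vert d))}"
      using rot_cycle(2)[of d "vert d"] d(1) b unfolding rot_def by auto
    then show ?thesis unfolding S cyc_interval_def by blast
  next
    case False
    then show ?thesis using bin d(1) ij unfolding S_def binary_at_vertices_def by auto
  qed
  then obtain x k where xk: "S = {(sigma ^^ i) x | i. i < k}" unfolding cyc_interval_def by blast
  have const: "face ((sigma ^^ m) x) \<in> unreached C \<longleftrightarrow> face x \<in> unreached C" if "m < k" for m
    using that
  proof (induction m)
    case (Suc m)
    define e where "e = (sigma ^^ Suc m) x"
    have "m < k" using Suc.prems by simp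
    then have "(sigma ^^ m) x \<in> S" "e \<in> S" unfolding e_def xk using Suc.prems by blast+
    then have e: "e \<in> D" "si e = (sigma ^^ m) x" "lab e = j" "lab (si e) = j"
      unfolding S_def e_def by auto
    \<comment> \<open>As an arc, \<open>e\<close> would need different labels at its tail;
      \<open>alpha e\<close> would have head label \<open>j\<close>, not \<open>i\<close>.\<close>
    have "e \<notin> C" "alpha e \<notin> C" using e C ij unfolding arcs_def by auto
    then have "face e \<in> unreached C \<longleftrightarrow> face (si e) \<in> unreached C"
      using unreached_cross[OF e(1)] face_si[OF e(1)] by simp
    then show ?case using Suc.IH \<open>m < k\<close> e(2) unfolding e_def by simp
  qed simp
  have "d \<in> S" "d' \<in> S" using d unfolding S_def by auto
  then show ?thesis using const unfolding xk by auto
qed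

text \<open>The new set consists of the arcs of colour \<open>j\<close> inside the region
  \<open>K\<close> cut off by \<open>C\<close>. It has no edge of \<open>C\<close>, so it does not
  block the boundary of \<open>K\<close>, and a face of \<open>K\<close> next to that boundary
  becomes reachable.\<close>

lemma closed_arcs_descent:
  assumes C: "C \<subseteq> arcs lab i" "C \<noteq> {}" "\<forall>d\<in>C. vert (alpha d) \<in> vert ` C"
    and ij: "i \<in> {0, 1}" "j = 1 - i"
  obtains C' where "C' \<subseteq> arcs lab j" "C' \<noteq> {}" "\<forall>d\<in>C'. vert (alpha d) \<in> vert ` C'"
    "unreached C' \<subset> unreached C"
proof -
  define K where "K = unreached C"
  have CD: "C \<subseteq> D" using C(1) arcs_in by auto
  have Cdisj: "C \<inter> alpha ` C = {}" using C(1) arcs_oriented by blast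
  obtain d0 where d0: "d0 \<in> D" "face d0 \<in> K"
    using closed_dart_set_separates[OF imageI[OF outer] CD C(2) Cdisj C(3)[rule_format]]
    unfolding K_def unreached_def by auto
  have arc_not_C: "e \<notin> C" "alpha e \<notin> C" if "e \<in> arcs lab j" for e
    using that C(1) ij arcs_disjoint[of e i j] arcs_oriented[of e j i] by auto
  \<comment> \<open>The two labels at the tail of an outgoing arc differ, so one side has label
    \<open>j\<close> and lies in \<open>K\<close> together with \<open>x\<close>. The arc is not an
    edge of \<open>C\<close>, hence its other side lies in \<open>K\<close> too.\<close>
  have out: "\<exists>e\<in>arcs lab j. vert e = vert x \<and> face e \<in> K"
    if x: "x \<in> D" "lab x = j" "face x \<in> K" for x
  proof -
    have "vert x \<noteq> sink j"
    proof
      assume xs: "vert x = sink j"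
      obtain c where c: "c \<in> face outer" "vert c = sink j"
        using s0_outer s1_outer unfolding sink_def by (metis imageE)
      then have cD: "c \<in> D" using face_subset[OF outer] by auto
      have "lab c = j" using special_labels[OF cD] c ij unfolding sink_def by (auto split: if_splits)
      then have "face c \<in> K"
        using same_label_same_side[OF C(1) ij x(1) cD] x xs c unfolding K_def by simp
      then show False using face_eq[OF outer c(1)] outer_reached unfolding K_def by simp
    qed
    moreover have "vert x \<noteq> sink i" using special_labels x ij unfolding sink_def by auto
    ultimately have "vert x \<notin> {s0, s1}" using ij unfolding sink_def by auto
    moreover have "j \<in> {0, 1}" using ij by auto
    ultimately have "card {e\<in>arcs lab j. vert e = vert x} = 1" using card_out_arcs x(1) by blast
    then have "{e\<in>arcs lab j. vert e = vert x} \<noteq> {}" by (metis card.empty zero_neq_one)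
    then obtain e where e: "e \<in> arcs lab j" "vert e = vert x" by auto
    have eD: "e \<in> D" "lab (si e) \<noteq> lab e" using e unfolding arcs_def by auto
    have "lab e = j \<or> lab (si e) = j"
      using eD binary_values[OF bin, of e] binary_values[OF bin, of "si e"] ij by auto
    then have "face e \<in> K \<or> face (si e) \<in> K"
      using same_label_same_side[OF C(1) ij x(1) eD(1)] eD e x
        same_label_same_side[OF C(1) ij x(1), of "si e"] unfolding K_def by auto
    then have "face e \<in> K"
      using unreached_cross[OF eD(1) arc_not_C[OF e(1)]] face_si[OF eD(1)] unfolding K_def by auto
    then show ?thesis using e by blast
  qed
  define C' where "C' = {e\<in>arcs lab j. face e \<in> K}"
  have 1: "C' \<subseteq> arcs lab j" unfolding C'_def by auto
  have 2: "C' \<noteq> {}"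
  proof -
    have "\<exists>x\<in>face d0. x \<in> D \<and> lab x = j"
    proof -
      have "lab d0 \<noteq> lab (ph d0) \<or> lab (ph d0) \<noteq> lab (ph (ph d0))"
        using alt d0(1) black_ph[OF d0(1)] ph_in[OF d0(1)] unfolding alternating_def by blast
      then have "\<exists>x\<in>{d0, ph d0, ph (ph d0)}. lab x = j"
        using binary_values[OF bin, of d0] binary_values[OF bin, of "ph d0"]
          binary_values[OF bin, of "ph (ph d0)"] d0 ij by auto
      then show ?thesis using face_cycle(2)[OF d0(1)] d0(1) by auto
    qed
    then obtain x where "x \<in> D" "lab x = j" "face x = face d0" using face_eq[OF d0(1)] by blast
    then show ?thesis using out[of x] d0 unfolding C'_def by auto
  qed
  have 3: "\<forall>d\<in>C'. vert (alpha d) \<in> vert ` C'"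
  proof
    fix d assume d: "d \<in> C'"
    have dj: "d \<in> arcs lab j" "face d \<in> K" using d unfolding C'_def by auto
    have dD: "d \<in> D" using arcs_in[OF dj(1)] .
    have "face (alpha d) \<in> K"
      using unreached_cross[OF dD arc_not_C[OF dj(1)]] dj unfolding K_def by simp
    moreover have "lab (alpha d) = j" using dj(1) unfolding arcs_def by simp
    ultimately obtain e where "e \<in> C'" "vert e = vert (alpha d)"
      using out[of "alpha d"] dD unfolding C'_def by auto
    then show "vert (alpha d) \<in> vert ` C'" by (metis imageI)
  qed
  have reach: "(face outer, g) \<in> (dual_step C')\<^sup>*" if "(face outer, g) \<in> (dual_step C)\<^sup>*" for g
    using that
  proof (induction rule: rtrancl_induct)
    case (step g g')
    then obtain d where d: "d \<in> D" "g = face d" "g' = face (alpha d)" unfolding dual_step_def by blast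
    have "g' \<notin> K" "g \<notin> K"
      using step(1,2) unfolding K_def unreached_def by (auto intro: rtrancl_into_rtrancl)
    then have "d \<notin> C'" "alpha d \<notin> C'" unfolding C'_def using d by auto
    then have "(g, g') \<in> dual_step C'" unfolding dual_step_def using d by blast
    then show ?case using step by (auto intro: rtrancl_into_rtrancl)
  qed simp
  have sub: "unreached C' \<subseteq> K" unfolding K_def unreached_def using reach by blast
  obtain e where e: "e \<in> D" "face e \<notin> K" "face (alpha e) \<in> K"
    using face_edge_leaves[OF outer d0(1), of "- K"] outer_reached[of C] d0 unfolding K_def by auto
  have "e \<in> C \<or> alpha e \<in> C" using unreached_cross[OF e(1), of C] e unfolding K_def by blast
  then have "e \<notin> C' \<and> alpha e \<notin> C'" using arc_not_C[of e] arc_not_C[of "alpha e"] e(1) 1 by auto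
  then have "(face e, face (alpha e)) \<in> dual_step C'" unfolding dual_step_def using e(1) by blast
  moreover have "(face outer, face e) \<in> (dual_step C')\<^sup>*"
    using e reach unfolding K_def unreached_def by blast
  ultimately have "face (alpha e) \<notin> unreached C'"
    unfolding unreached_def by (auto intro: rtrancl_into_rtrancl)
  then have "unreached C' \<subset> K" using sub e(3) by blast
  then show ?thesis using that[OF 1 2 3] unfolding K_def by blast
qed

lemma no_closed_arcs:
  assumes "C \<subseteq> arcs lab i" "C \<noteq> {}" "\<forall>d\<in>C. vert (alpha d) \<in> vert ` C" "i \<in> {0, 1}"
  shows False
  using assms
proof (induction "card (unreached C)" arbitrary: C i rule: less_induct)
  case less
  obtain C' where C': "C' \<subseteq> arcs lab (1 - i)" "C' \<noteq> {}" "\<forall>d\<in>C'. vert (alpha d) \<in> vert ` C'"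
    "unreached C' \<subset> unreached C"
    by (rule closed_arcs_descent[OF less.prems refl]) (rule that)
  have "finite (unreached C)" unfolding unreached_def by simp
  then have "card (unreached C') < card (unreached C)" using C'(4) by (rule psubset_card_mono)
  then show False using less.hyps[OF _ C'(1-3)] less.prems(4) by auto
qed

lemma arcs_directed_tree:
  assumes i: "i \<in> {0, 1}"
  shows "directed_tree_to alpha vert (arcs lab i) (sink i)"
proof -
  let ?A = "arcs lab i" and ?R = "{(vert d, vert (alpha d)) | d. d \<in> arcs lab i}"
  let ?W = "{sink i} \<union> vert ` ?A \<union> (\<lambda>d. vert (alpha d)) ` ?A"
  have tail: "vert d \<noteq> sink i" if "d \<in> ?A" for d using arcs_tail[OF that] unfolding sink_def by auto
  have inner: "v \<in> vert ` D \<and> v \<notin> {s0, s1}" if v: "v \<in> ?W" "v \<noteq> sink i" for v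
  proof -
    consider d where "d \<in> ?A" "v = vert d" | d where "d \<in> ?A" "v = vert (alpha d)" using v by auto
    then show ?thesis
    proof cases
      case 1 then show ?thesis using arcs_in arcs_tail by blast
    next
      case 2
      then have dD: "d \<in> D" "lab (alpha d) = i" unfolding arcs_def by auto
      then have "v \<notin> {s0, s1}"
        using special_labels[of "alpha d"] 2 v(2) i unfolding sink_def by (auto split: if_splits)
      then show ?thesis using 2 dD by auto
    qed
  qed
  have outdeg: "card {d\<in>?A. vert d = v} = 1" if "v \<in> ?W" "v \<noteq> sink i" for v
    using card_out_arcs inner[OF that] i by blast
  have "(v, sink i) \<in> ?R\<^sup>*" if v: "v \<in> ?W" for v
  proof (rule ccontr)
    assume nv: "(v, sink i) \<notin> ?R\<^sup>*"
    \<comment> \<open>The arcs from which the sink is unreachable: each head inherits this property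
      and has an outgoing arc, so the set is closed.\<close>
    define C where "C = {d\<in>?A. (vert d, sink i) \<notin> ?R\<^sup>*}"
    have ex: "u \<in> vert ` C" if u: "u \<in> ?W" "(u, sink i) \<notin> ?R\<^sup>*" for u
    proof -
      have "u \<noteq> sink i" using u by auto
      then have "{d\<in>?A. vert d = u} \<noteq> {}" using outdeg[OF u(1)] by (metis card.empty zero_neq_one)
      then show ?thesis using u unfolding C_def by auto
    qed
    have "vert (alpha d) \<in> vert ` C" if d: "d \<in> C" for d
    proof (rule ex)
      have dA: "d \<in> ?A" "(vert d, sink i) \<notin> ?R\<^sup>*" using d unfolding C_def by auto
      then show "vert (alpha d) \<in> ?W" by blast
      show "(vert (alpha d), sink i) \<notin> ?R\<^sup>*"
        using dA by (blast intro: converse_rtrancl_into_rtrancl)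
    qed
    moreover have "C \<noteq> {}" using ex[OF v nv] by auto
    moreover have "C \<subseteq> ?A" unfolding C_def by auto
    ultimately show False using no_closed_arcs i by blast
  qed
  then show ?thesis unfolding directed_tree_to_def Let_def using tail outdeg by blast
qed

lemma arcs_separating_decomposition:
  "separating_decomposition D alpha sigma vert black s0 s1 (arcs lab 0, arcs lab 1)"
proof -
  have part: "(d \<in> arcs lab 0 \<union> arcs lab 1) \<noteq> (alpha d \<in> arcs lab 0 \<union> arcs lab 1)" if "d \<in> D" for d
    using arcs_iff[OF that, of 0] arcs_iff[OF that, of 1] binary_values[OF bin, of "before d"] that
    by auto
  have order: "\<exists>d\<in>D. vert d = v \<and> (\<exists>a. a + 1 < card (star v) \<and>
                (\<forall>j<a. alpha ((rot v ^^ j) d) \<in> arcs lab 0) \<and>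
                (rot v ^^ a) d \<in> arcs lab 0 \<and>
                (\<forall>j. a < j \<and> j + 1 < card (star v) \<longrightarrow> alpha ((rot v ^^ j) d) \<in> arcs lab 1) \<and>
                (rot v ^^ (card (star v) - 1)) d \<in> arcs lab 1)"
    if v: "v \<in> vert ` D" "v \<notin> {s0, s1}" for v
  proof -
    obtain z k where z: "z \<in> star v" "0 < k" "k < card (star v)"
      "\<And>j. j < card (star v) \<Longrightarrow> lab ((rot v ^^ j) z) = (if j < k then 0 else 1)"
      by (rule vertex_intervals[OF v]) (rule that)
    define n where "n = card (star v)"
    \<comment> \<open>The dart between the angles number \<open>j\<close> and \<open>j + 1\<close>.
      The change from 0 to 1 makes number \<open>k - 1\<close> the outgoing arc of colour 0, and the
      wrap-around makes number \<open>n - 1\<close> that of colour 1.\<close>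
    define e where "e j = (rot v ^^ j) (after_angle z)" for j
    have e: "e j \<in> D" "before (e j) = (rot v ^^ j) z" "after (e j) = (rot v ^^ Suc j) z" for j
    proof -
      have ej: "e j = after_angle ((rot v ^^ j) z)"
        using funpow_rot_after_angle[of z j] z(1) unfolding e_def by auto
      then show *: "e j \<in> D" "before (e j) = (rot v ^^ j) z" using z(1) before_after_angle by auto
      show "after (e j) = (rot v ^^ Suc j) z" using rot_before[OF *(1)] *(2) ej z(1) by auto
    qed
    have lab_n: "lab ((rot v ^^ n) z) = 0"
      using rot_cycle(1)[OF z(1)] z(4)[of 0] z(2,3) unfolding n_def by simp
    have l: "lab ((rot v ^^ j) z) = (if j < k then 0 else 1)" if "j < n" for j
      using z(4) that unfolding n_def by simp
    have kn: "k < n" using z(3) unfolding n_def .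
    have "\<forall>j<k - 1. alpha (e j) \<in> arcs lab 0"
    proof (intro allI impI)
      fix j assume "j < k - 1"
      then show "alpha (e j) \<in> arcs lab 0"
        using arcs_iff(2)[OF e(1)[of j], of 0] e(2,3)[of j] l[of j] l[of "Suc j"] kn by simp
    qed
    moreover have "e (k - 1) \<in> arcs lab 0"
      using arcs_iff(1)[OF e(1)[of "k - 1"], of 0] e(2,3)[of "k - 1"] l[of "k - 1"] l[of k] kn z(2)
      by simp
    moreover have "\<forall>j. k - 1 < j \<and> j + 1 < n \<longrightarrow> alpha (e j) \<in> arcs lab 1"
    proof (intro allI impI)
      fix j assume "k - 1 < j \<and> j + 1 < n"
      then have "\<not> j < k" "\<not> Suc j < k" "j < n" "Suc j < n" by auto
      then show "alpha (e j) \<in> arcs lab 1"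
        using arcs_iff(2)[OF e(1)[of j], of 1] e(2,3)[of j] l[of j] l[of "Suc j"] by simp
    qed
    moreover have "e (n - 1) \<in> arcs lab 1"
      using arcs_iff(1)[OF e(1)[of "n - 1"], of 1] e(2,3)[of "n - 1"] l[of "n - 1"] lab_n kn z(2)
      by simp
    moreover have "k - 1 + 1 < n" using kn z(2) by simp
    ultimately show ?thesis
      using z(1) unfolding e_def n_def
      by (intro bexI[of _ "after_angle z"] conjI exI[of _ "k - 1"]) auto
  qed
  have "arcs lab 0 \<inter> arcs lab 1 = {}" using arcs_disjoint by fastforce
  moreover have "directed_tree_to alpha vert (arcs lab 0) s0" "directed_tree_to alpha vert (arcs lab 1) s1"
    using arcs_directed_tree[of 0] arcs_directed_tree[of 1] unfolding sink_def by auto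
  moreover have "arcs lab 0 \<subseteq> D" "arcs lab 1 \<subseteq> D" using arcs_in by auto
  ultimately show ?thesis
    unfolding separating_decomposition_def Let_def fst_conv snd_conv rot_def[symmetric]
    by (intro conjI ballI impI part order)
qed

end

text \<open>Each dart lies in exactly one face orbit of length 4. Together with Euler's formula this
  gives 2V - 4 edges.\<close>

lemma card_darts: "card D = 4 * card (face ` D)"
proof -
  have U: "\<Union>(face ` D) = D" using face_subset by (auto intro: self_in_face)
  have "4 * card (face ` D) = card (\<Union>(face ` D))"
  proof (rule card_partition)
    show "\<And>c. c \<in> face ` D \<Longrightarrow> card c = 4" using face_card by auto
    show "c1 \<inter> c2 = {}" if c: "c1 \<in> face ` D" "c2 \<in> face ` D" "c1 \<noteq> c2" for c1 c2
    proof (rule ccontr)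
      obtain d1 d2 where d: "d1 \<in> D" "c1 = face d1" "d2 \<in> D" "c2 = face d2" using c by blast
      assume "c1 \<inter> c2 \<noteq> {}"
      then obtain x where "x \<in> face d1" "x \<in> face d2" using d by blast
      then have "face d1 = face d2" using face_eq d by metis
      then show False using d c by simp
    qed
  qed (use U in auto)
  then show ?thesis using U by simp
qed

section \<open>From decompositions to labelings\<close>

text \<open>In a decomposition every edge outside \<open>T0\<close> belongs to \<open>T1\<close>, so
  the first tree determines both colours.\<close>

definition tree_colour :: "'d set \<Rightarrow> 'd \<Rightarrow> nat" where
  "tree_colour T0 d = (if d \<in> T0 \<or> alpha d \<in> T0 then 0 else 1)"

definition tree_labeling :: "'d set \<Rightarrow> 'd \<Rightarrow> nat" where
  "tree_labeling T0 = (\<lambda>x\<in>D. tree_colour T0 (after_angle x))"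

text \<open>The angle \<open>x\<close> is \<open>before\<close> the dart
  \<open>after_angle x\<close>, so its label is the colour of that edge. Outside \<open>D\<close>
  both functions are undefined by extensionality.\<close>

lemma tree_labeling_arcs:
  assumes "binary_at_vertices lab" "alternating lab"
  shows "tree_labeling (arcs lab 0) = lab"
proof
  fix x
  show "tree_labeling (arcs lab 0) x = lab x"
  proof (cases "x \<in> D")
    case True
    have "lab x = 0 \<or> lab x = 1" using binary_values[OF assms(1) True] .
    then show ?thesis
      using arcs_iff[OF assms, of "after_angle x" 0] before_after_angle[OF True] True
      unfolding tree_labeling_def tree_colour_def by auto
  next
    case False
    then show ?thesis
      using assms(1) unfolding tree_labeling_def binary_at_vertices_def PiE_def extensional_def by auto
  qed
qed

context
  fixes T0 T1
  assumes sd: "separating_decomposition D alpha sigma vert black s0 s1 (T0, T1)"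
begin

lemma trees_in: "T0 \<subseteq> D" "T1 \<subseteq> D" and trees_disjoint: "T0 \<inter> T1 = {}"
  and trees_partition: "d \<in> D \<Longrightarrow> (d \<in> T0 \<union> T1) \<noteq> (alpha d \<in> T0 \<union> T1)"
  and tree0: "directed_tree_to alpha vert T0 s0" and tree1: "directed_tree_to alpha vert T1 s1"
  using sd unfolding separating_decomposition_def Let_def fst_conv snd_conv by blast+

lemma vertex_order:
  assumes "v \<in> vert ` D" "v \<notin> {s0, s1}"
  shows "\<exists>d\<in>D. vert d = v \<and> (\<exists>a. a + 1 < card (star v) \<and>
                (\<forall>j<a. alpha ((rot v ^^ j) d) \<in> T0) \<and>
                (rot v ^^ a) d \<in> T0 \<and>
                (\<forall>j. a < j \<and> j + 1 < card (star v) \<longrightarrow> alpha ((rot v ^^ j) d) \<in> T1) \<and>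
                (rot v ^^ (card (star v) - 1)) d \<in> T1)"
  using sd[unfolded separating_decomposition_def Let_def fst_conv snd_conv, folded rot_def] assms
  by blast

text \<open>By Euler's formula there are twice as many edges as vertices other than the sinks, so
  the two outgoing edges required at each of these exhaust all edges.\<close>

lemma sinks_no_out:
  assumes "d \<in> T0 \<union> T1"
  shows "vert d \<notin> {s0, s1}"
proof -
  define V where "V = vert ` D - {s0, s1}"
  have "\<forall>v\<in>V. \<exists>d. d \<in> T0 \<and> vert d = v"
  proof
    fix v assume "v \<in> V"
    then obtain d a where "d \<in> D" "vert d = v" "(rot v ^^ a) d \<in> T0"
      using vertex_order[of v] unfolding V_def by blast
    then show "\<exists>d. d \<in> T0 \<and> vert d = v" by (metis funpow_rot_in(2))
  qed
  then obtain t0 where t0: "\<And>v. v \<in> V \<Longrightarrow> t0 v \<in> T0 \<and> vert (t0 v) = v" by metis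
  have "\<forall>v\<in>V. \<exists>d. d \<in> T1 \<and> vert d = v"
  proof
    fix v assume "v \<in> V"
    then obtain d a where "d \<in> D" "vert d = v" "(rot v ^^ a) d \<in> T1"
      using vertex_order[of v] unfolding V_def by blast
    then show "\<exists>d. d \<in> T1 \<and> vert d = v" by (metis funpow_rot_in(2))
  qed
  then obtain t1 where t1: "\<And>v. v \<in> V \<Longrightarrow> t1 v \<in> T1 \<and> vert (t1 v) = v" by metis
  have finV: "finite V" unfolding V_def by simp
  have "card V = card (vert ` D) - card {s0, s1}"
    unfolding V_def using special_in by (intro card_Diff_subset) auto
  moreover have "card {s0, s1} \<le> card (vert ` D)"
    using special_in by (intro card_mono) auto
  ultimately have cardV: "card V + 2 = card (vert ` D)" using s by simp
  have sub: "t0 ` V \<union> t1 ` V \<subseteq> T0 \<union> T1" using t0 t1 by auto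
  have "inj_on t0 V" "inj_on t1 V" using t0 t1 by (metis inj_onI)+
  moreover have "t0 ` V \<subseteq> T0" "t1 ` V \<subseteq> T1" using t0 t1 by auto
  then have "t0 ` V \<inter> t1 ` V = {}" using trees_disjoint by blast
  ultimately have c1: "card (t0 ` V \<union> t1 ` V) = 2 * card V"
    using finV by (simp add: card_Un_disjoint card_image)
  have disj: "(T0 \<union> T1) \<inter> alpha ` (T0 \<union> T1) = {}" using trees_partition trees_in by blast
  have all: "(T0 \<union> T1) \<union> alpha ` (T0 \<union> T1) = D"
  proof
    show "D \<subseteq> (T0 \<union> T1) \<union> alpha ` (T0 \<union> T1)"
    proof
      fix x assume x: "x \<in> D"
      then have "x \<in> T0 \<union> T1 \<or> alpha x \<in> T0 \<union> T1" using trees_partition by blast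
      then show "x \<in> (T0 \<union> T1) \<union> alpha ` (T0 \<union> T1)" 
        using alpha_alpha[OF x] image_eqI[of x alpha "alpha x"] by auto
    qed
  qed (use trees_in in auto)
  have c2: "2 * card (T0 \<union> T1) = card D"
    using card_with_alpha[OF _ disj] trees_in all by simp
  have "2 * card (vert ` D) + 2 * card (face ` D) = card D + 4" using euler by simp
  then have "card (T0 \<union> T1) = 2 * card V" using c2 cardV card_darts by linarith
  moreover have "finite (T0 \<union> T1)" using trees_in finite_D finite_subset by (metis Un_least)
  ultimately have "t0 ` V \<union> t1 ` V = T0 \<union> T1" using card_subset_eq[OF _ sub] c1 by simp
  then have "d \<in> t0 ` V \<union> t1 ` V" using assms by blast
  then have "vert d \<in> V" using t0 t1 by auto
  then show ?thesis unfolding V_def by blast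
qed

text \<open>All edges at a sink enter it. An entering arc of the other tree, whose root lies
  elsewhere, would force an outgoing arc.\<close>

lemma sinks_in:
  assumes y: "y \<in> D"
  shows "vert y = s0 \<Longrightarrow> alpha y \<in> T0" "vert y = s1 \<Longrightarrow> alpha y \<in> T1"
proof -
  have in_T: "alpha y \<in> T0 \<union> T1" if "vert y \<in> {s0, s1}"
    using trees_partition[OF y] sinks_no_out[of y] that by blast
  show "alpha y \<in> T0" if v: "vert y = s0"
    using in_T directed_tree_head_out[OF tree1, of "alpha y"] sinks_no_out y v s by auto
  show "alpha y \<in> T1" if v: "vert y = s1"
    using in_T directed_tree_head_out[OF tree0, of "alpha y"] sinks_no_out y v s by auto
qed

abbreviation "col \<equiv> tree_colour T0"

lemma col_T0: "d \<in> D \<Longrightarrow> d \<in> T0 \<or> alpha d \<in> T0 \<Longrightarrow> col d = 0"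
  unfolding tree_colour_def by auto

lemma col_T1: "d \<in> D \<Longrightarrow> d \<in> T1 \<or> alpha d \<in> T1 \<Longrightarrow> col d = 1"
  using trees_partition[of d] trees_disjoint unfolding tree_colour_def by auto

lemma col_alpha: "d \<in> D \<Longrightarrow> col (alpha d) = col d"
  unfolding tree_colour_def by auto

lemma col_order:
  assumes "v \<in> vert ` D" "v \<notin> {s0, s1}"
  shows "\<exists>d a. d \<in> star v \<and> a + 1 < card (star v) \<and>
    (\<forall>j<card (star v). col ((rot v ^^ j) d) = (if j \<le> a then 0 else 1) \<and>
       (j < a \<longrightarrow> alpha ((rot v ^^ j) d) \<in> T0) \<and>
       (j = a \<longrightarrow> (rot v ^^ j) d \<in> T0) \<and>
       (a < j \<and> j + 1 < card (star v) \<longrightarrow> alpha ((rot v ^^ j) d) \<in> T1) \<and>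
       (j + 1 = card (star v) \<longrightarrow> (rot v ^^ j) d \<in> T1))"
proof -
  obtain d a where d: "d \<in> D" "vert d = v" and a: "a + 1 < card (star v)"
      "\<forall>j<a. alpha ((rot v ^^ j) d) \<in> T0" "(rot v ^^ a) d \<in> T0"
      "\<forall>j. a < j \<and> j + 1 < card (star v) \<longrightarrow> alpha ((rot v ^^ j) d) \<in> T1"
      "(rot v ^^ (card (star v) - 1)) d \<in> T1"
    using vertex_order[OF assms] by blast
  have "col ((rot v ^^ j) d) = (if j \<le> a then 0 else 1)" if j: "j < card (star v)" for j
  proof -
    consider "j < a" | "j = a" | "a < j" "j + 1 < card (star v)" | "a < j" "j = card (star v) - 1"
      using j by linarith
    then show ?thesis
    proof cases
      case 1 then show ?thesis using col_T0[of "(rot v ^^ j) d"] a(2) d by simp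
    next
      case 2 then show ?thesis using col_T0[of "(rot v ^^ j) d"] a(3) d by simp
    next
      case 3 then show ?thesis using col_T1[of "(rot v ^^ j) d"] a(4) d by simp
    next
      case 4 then show ?thesis using col_T1[of "(rot v ^^ j) d"] a(5) d by simp
    qed
  qed
  moreover have "(rot v ^^ j) d \<in> T1" if "j + 1 = card (star v)" for j
    using a(5) that[symmetric] by simp
  ultimately show ?thesis using d a(1-4) by blast
qed

text \<open>In the order around an inner vertex exactly the outgoing edges are followed by an edge
  of the other colour. At a sink all edges enter and have one colour, so the rule persists
  there.\<close>

lemma rot_colour:
  assumes y: "y \<in> D"
  shows "col (rot (vert y) y) = 0 \<and> (alpha y \<in> T0 \<or> y \<in> T1) \<or>
         col (rot (vert y) y) = 1 \<and> (alpha y \<in> T1 \<or> y \<in> T0)"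
proof (cases "vert y \<in> {s0, s1}")
  case True
  have "rot (vert y) y \<in> D" "vert (rot (vert y) y) = vert y" using y by auto
  then show ?thesis
    using True sinks_in[OF y] sinks_in[of "rot (vert y) y"] col_T0[of "rot (vert y) y"]
      col_T1[of "rot (vert y) y"] by auto
next
  case False
  define v where "v = vert y"
  define n where "n = card (star v)"
  obtain d a where d: "d \<in> star v" "a + 1 < n"
    and o: "\<And>j. j < n \<Longrightarrow> col ((rot v ^^ j) d) = (if j \<le> a then 0 else 1) \<and>
       (j < a \<longrightarrow> alpha ((rot v ^^ j) d) \<in> T0) \<and>
       (j = a \<longrightarrow> (rot v ^^ j) d \<in> T0) \<and>
       (a < j \<and> j + 1 < n \<longrightarrow> alpha ((rot v ^^ j) d) \<in> T1) \<and>
       (j + 1 = n \<longrightarrow> (rot v ^^ j) d \<in> T1)"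
    using col_order[of v] y False unfolding v_def n_def by blast
  have "y \<in> star v" using y unfolding v_def by simp
  then obtain j where j: "j < n" "y = (rot v ^^ j) d" using rot_cycle(2)[OF d(1)] unfolding n_def by auto
  have r: "rot v y = (rot v ^^ Suc j) d" using j by simp
  show ?thesis
  proof (cases "Suc j = n")
    case True
    then have "rot v y = (rot v ^^ 0) d" using r rot_cycle(1)[OF d(1)] unfolding n_def by simp
    then have "col (rot v y) = 0" using o[of 0] d(2) by simp
    moreover have "y \<in> T1" using o[OF j(1)] True j(2) by simp
    ultimately show ?thesis unfolding v_def by simp
  next
    case False
    then have "Suc j < n" using j by simp
    then have "col (rot v y) = (if Suc j \<le> a then 0 else 1)" using o[of "Suc j"] r by simp
    moreover have "Suc j \<le> a \<Longrightarrow> alpha y \<in> T0" using o[OF j(1)] j(2) by simp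
    moreover have "\<not> Suc j \<le> a \<Longrightarrow> alpha y \<in> T1 \<or> y \<in> T0"
      using o[OF j(1)] j(2) \<open>Suc j < n\<close> by (cases "j = a") auto
    ultimately show ?thesis unfolding v_def by auto
  qed
qed

lemma tree_labeling_eq: "x \<in> D \<Longrightarrow> tree_labeling T0 x = col (after_angle x)"
  unfolding tree_labeling_def by simp

text \<open>After a black angle both labels read off the same edge. After a white angle they read
  off the rotation successors of the two darts of one edge; as this edge leaves one end and enters
  the other, \<open>rot_colour\<close> gives different colours.\<close>

lemma tree_labeling_alternating: "alternating (tree_labeling T0)"
  unfolding alternating_def
proof
  fix d assume d: "d \<in> D"
  show "tree_labeling T0 d = tree_labeling T0 (ph d) \<longleftrightarrow> black (vert d)"
  proof (cases "black (vert d)")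
    case True
    then have "tree_labeling T0 (ph d) = col (alpha (sigma d))"
      using tree_labeling_eq[OF ph_in[OF d]] black_ph[OF d]
      unfolding after_angle_def by (simp add: phi_def)
    then show ?thesis
      using True d tree_labeling_eq[OF d] col_alpha unfolding after_angle_def by simp
  next
    case False
    have "tree_labeling T0 d = col d" using False tree_labeling_eq[OF d] unfolding after_angle_def by simp
    moreover have "tree_labeling T0 (ph d) = col (sigma (ph d))"
      using tree_labeling_eq[OF ph_in[OF d]] black_ph[OF d] False unfolding after_angle_def by simp
    moreover have "rot (vert (sigma d)) (sigma d) = d" using False d unfolding rot_def by simp
    moreover have "rot (vert (ph d)) (ph d) = sigma (ph d)" using False black_ph[OF d] unfolding rot_def by simp
    moreover have "alpha (ph d) = sigma d" "alpha (sigma d) = ph d" using d unfolding phi_def by simp_all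
    ultimately have "tree_labeling T0 d \<noteq> tree_labeling T0 (ph d)"
      using rot_colour[of "sigma d"] rot_colour[of "ph d"] d trees_partition[of "sigma d"] trees_disjoint
      by auto
    then show ?thesis using False by simp
  qed
qed

lemma tree_labeling_intervals:
  assumes "v \<in> vert ` D" "v \<notin> {s0, s1}"
  defines "Z \<equiv> {d\<in>D. vert d = v \<and> tree_labeling T0 d = 0}"
    and "N \<equiv> {d\<in>D. vert d = v \<and> tree_labeling T0 d = 1}"
  shows "Z \<noteq> {}" "N \<noteq> {}" "cyc_interval sigma Z" "cyc_interval sigma N"
proof -
  define n where "n = card (star v)"
  obtain d a where d: "d \<in> star v" and a: "a + 1 < n"
    and c: "\<And>j. j < n \<Longrightarrow> col ((rot v ^^ j) d) = (if j \<le> a then 0 else 1)"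
    using col_order[OF assms(1,2)] unfolding n_def by blast
  \<comment> \<open>The angle just before \<open>d\<close>: from here on, angle labels and edge
    colours agree position by position.\<close>
  define z where "z = before d"
  have z: "z \<in> star v" "after_angle z = d" using d after_angle_before unfolding z_def by auto
  note cyc = rot_cycle[OF z(1), folded n_def]
  have lab: "tree_labeling T0 ((rot v ^^ j) z) = (if j \<le> a then 0 else 1)" if "j < n" for j
    using c[OF that] tree_labeling_eq[of "(rot v ^^ j) z"] funpow_rot_after_angle[of z j] z by auto
  have Z: "Z = {(rot v ^^ j) z | j. j < a + 1}"
  proof (intro equalityI subsetI)
    fix x assume x: "x \<in> Z"
    then have "x \<in> star v" unfolding Z_def by simp
    then obtain j where j: "j < n" "x = (rot v ^^ j) z" using cyc(2) by auto
    have "tree_labeling T0 ((rot v ^^ j) z) = 0" using x j(2) unfolding Z_def by simp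
    then have "j \<le> a" using lab[OF j(1)] by (cases "j \<le> a") simp_all
    then show "x \<in> {(rot v ^^ j) z | j. j < a + 1}" using j by auto
  next
    fix x assume "x \<in> {(rot v ^^ j) z | j. j < a + 1}"
    then obtain j where "j \<le> a" "x = (rot v ^^ j) z" by (auto simp: less_Suc_eq_le)
    then show "x \<in> Z" using lab[of j] a z(1) unfolding Z_def by auto
  qed
  have N: "N = {(rot v ^^ j) ((rot v ^^ (a + 1)) z) | j. j < n - (a + 1)}"
  proof (intro equalityI subsetI)
    fix x assume x: "x \<in> N"
    then have "x \<in> star v" unfolding N_def by simp
    then obtain j where j: "j < n" "x = (rot v ^^ j) z" using cyc(2) by auto
    have "tree_labeling T0 ((rot v ^^ j) z) = 1" using x j(2) unfolding N_def by simp
    then have "a < j" using lab[OF j(1)] by (cases "j \<le> a") simp_all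
    then have "x = (rot v ^^ (j - (a + 1))) ((rot v ^^ (a + 1)) z)"
      using j(2) funpow_add[of "j - (a + 1)" "a + 1" "rot v"] by (simp del: funpow.simps)
    moreover have "j - (a + 1) < n - (a + 1)" using j(1) \<open>a < j\<close> by linarith
    ultimately show "x \<in> {(rot v ^^ j) ((rot v ^^ (a + 1)) z) | j. j < n - (a + 1)}" by blast
  next
    fix x assume "x \<in> {(rot v ^^ j) ((rot v ^^ (a + 1)) z) | j. j < n - (a + 1)}"
    then obtain j where "j < n - (a + 1)" and j': "x = (rot v ^^ j) ((rot v ^^ (a + 1)) z)" by blast
    then have j: "j + (a + 1) < n" by linarith
    have "x = (rot v ^^ (j + (a + 1))) z" using j' by (simp only: funpow_add comp_apply)
    then show "x \<in> N" using lab[OF j] z(1) unfolding N_def by auto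
  qed
  have "z \<in> Z" unfolding Z by (auto intro: exI[of _ 0])
  then show "Z \<noteq> {}" by blast
  have "(rot v ^^ (a + 1)) z \<in> N" unfolding N using a by (auto intro!: exI[of _ 0])
  then show "N \<noteq> {}" by blast
  have "cyc_interval (rot v) Z" unfolding cyc_interval_def using Z by blast
  then show "cyc_interval sigma Z" using cyc_interval_rot_iff[of Z v] unfolding Z_def by auto
  have "cyc_interval (rot v) N" unfolding cyc_interval_def using N by blast
  then show "cyc_interval sigma N" using cyc_interval_rot_iff[of N v] unfolding N_def by auto
qed

lemma tree_labeling_binary: "binary_at_vertices (tree_labeling T0)"
proof -
  have "tree_labeling T0 \<in> D \<rightarrow>\<^sub>E {0, 1}"
    unfolding tree_labeling_def tree_colour_def by auto
  moreover have "(vert d = s0 \<longrightarrow> tree_labeling T0 d = 0) \<and> (vert d = s1 \<longrightarrow> tree_labeling T0 d = 1)"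
    if "d \<in> D" for d
    using sinks_in[of "after_angle d"] col_T0[of "after_angle d"] col_T1[of "after_angle d"]
      tree_labeling_eq[OF that] that by auto
  ultimately show ?thesis
    unfolding binary_at_vertices_def using tree_labeling_intervals by blast
qed

text \<open>The angles before and after a dart carry the colours of its edge and of the next one,
  which differ at outgoing edges. This puts each tree into its colour class; an arc outside both
  trees would have its reverse in a tree, hence also among the arcs.\<close>

lemma arcs_tree_labeling: "(arcs (tree_labeling T0) 0, arcs (tree_labeling T0) 1) = (T0, T1)"
proof -
  let ?lab = "tree_labeling T0"
  note good = tree_labeling_binary tree_labeling_alternating
  have labs: "?lab (before d) = col d" "?lab (after d) = col (rot (vert d) d)" if "d \<in> D" for d
    using that tree_labeling_eq[of "before d"] tree_labeling_eq[of "after d"]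
    unfolding before_def after_def after_angle_def rot_def by auto
  have T0: "d \<in> arcs ?lab 0" if d: "d \<in> T0" for d
  proof -
    have dD: "d \<in> D" using d trees_in by blast
    have "col d = 0" using col_T0[OF dD] d by blast
    moreover have "col (rot (vert d) d) = 1"
      using rot_colour[OF dD] trees_partition[OF dD] trees_disjoint d by blast
    ultimately show ?thesis using arcs_iff(1)[OF good dD, of 0] labs[OF dD] by simp
  qed
  have T1: "d \<in> arcs ?lab 1" if d: "d \<in> T1" for d
  proof -
    have dD: "d \<in> D" using d trees_in by blast
    have "col d = 1" using col_T1[OF dD] d by blast
    moreover have "col (rot (vert d) d) = 0"
      using rot_colour[OF dD] trees_partition[OF dD] trees_disjoint d by blast
    ultimately show ?thesis using arcs_iff(1)[OF good dD, of 1] labs[OF dD] by simp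
  qed
  have in_trees: "d \<in> T0 \<union> T1" if d: "d \<in> arcs ?lab i" for d i
  proof (rule ccontr)
    assume "d \<notin> T0 \<union> T1"
    moreover have "d \<in> D" using d unfolding arcs_def by simp
    ultimately have "alpha d \<in> T0 \<union> T1" using trees_partition by blast
    then show False using T0 T1 arcs_oriented[OF good d] by blast
  qed
  have "arcs ?lab 0 = T0"
    using T0 T1 in_trees[of _ 0] arcs_disjoint[OF good, of _ 0 1] by (metis Un_iff subsetI subset_antisym zero_neq_one)
  moreover have "arcs ?lab 1 = T1"
    using T0 T1 in_trees[of _ 1] arcs_disjoint[OF good, of _ 0 1] by (metis Un_iff subsetI subset_antisym zero_neq_one)
  ultimately show ?thesis by simp
qed

end

end

section \<open>The two constructions as mutually inverse maps\<close>

theorem theorem22: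
  fixes D :: "'d set" and alpha sigma :: "'d \<Rightarrow> 'd" and vert :: "'d \<Rightarrow> 'v"
    and outer :: 'd and black :: "'v \<Rightarrow> bool" and s0 s1 :: 'v
  assumes "quadrangulation D alpha sigma vert"
    and "outer \<in> D"
    and "proper_bw_coloring D alpha vert black"
    and "s0 \<noteq> s1" and "black s0" and "black s1"
    and "s0 \<in> vert ` face_of alpha sigma outer" and "s1 \<in> vert ` face_of alpha sigma outer"
  shows "\<exists>f. bij_betw f {lab. strong_labeling D alpha sigma vert outer s0 s1 lab}
                        {T. separating_decomposition D alpha sigma vert black s0 s1 T}"
proof -
  interpret coloured_quadrangulation D alpha sigma vert outer black s0 s1
    using assms by unfold_locales
  let ?L = "{lab. strong_labeling D alpha sigma vert outer s0 s1 lab}"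
  let ?S = "{T. separating_decomposition D alpha sigma vert black s0 s1 T}"
  have "bij_betw (\<lambda>lab. (arcs lab 0, arcs lab 1)) ?L ?S"
  proof (rule bij_betw_byWitness[where f' = "\<lambda>T. tree_labeling (fst T)"])
    show "\<forall>lab\<in>?L. tree_labeling (fst (arcs lab 0, arcs lab 1)) = lab"
      using tree_labeling_arcs by (simp add: strong_labeling_iff)
    show "\<forall>T\<in>?S. (arcs (tree_labeling (fst T)) 0, arcs (tree_labeling (fst T)) 1) = T"
      using arcs_tree_labeling by force
    show "(\<lambda>lab. (arcs lab 0, arcs lab 1)) ` ?L \<subseteq> ?S"
      using arcs_separating_decomposition by (auto simp: strong_labeling_iff)
    show "(\<lambda>T. tree_labeling (fst T)) ` ?S \<subseteq> ?L"
      using tree_labeling_binary tree_labeling_alternating by (auto simp: strong_labeling_iff)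
  qed
  then show ?thesis by blast
qed

end
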